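(* Let $g$ be a strongly additive function with $0\le g(p)\le M$ for all primes $p$ (for some constant $M$) and $B(g;x)\to\infty$ as $x\to\infty$. Suppose there is a distribution function $\Psi\neq\delta_0$ such that $\Psi(\alpha)-\Psi(0)=1$ for some $\alpha>0$, and such that, for every fixed $\varepsilon>0$, \[ \frac{1}{x}\,\#\Big\{n\le x:\ \frac{g(n)-\mu(g;x)}{B(g;x)}\ge\Delta\Big\}\ \sim\ \mathbb{P}\big(\mathcal{Z}_\Psi(B(g;x)^2)\ge \Delta\, B(g;x)\big) \] as $x\to\infty$, uniformly in $1\le\Delta\ll B(g;x)^{1-\varepsilon}$. Then \[ \lim_{x\to\infty}\frac{1}{B(g;x)^2}\sum_{\substack{p\le x\\ g(p)\le t}}\frac{g(p)^2}{p}=\Psi(t) \] at every continuity point $t$ of $\Psi$.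
   Context: A function $g:\mathbb{N}\to\mathbb{R}$ is strongly additive if $g(mn)=g(m)+g(n)$ whenever $\gcd(m,n)=1$ and $g(p^k)=g(p)$ for all primes $p$, $k\ge1$. Sums over $p$ are over primes; $\mu(g;x)=\sum_{p\le x}g(p)/p$, $B(g;x)^2=\sum_{p\le x}g(p)^2/p$. $\delta_0$ is the distribution function of the point mass at $0$. For a distribution function $\Psi$ with $\Psi(\alpha)-\Psi(0)=1$ for some $\alpha>0$, $\{\mathcal{Z}_\Psi(u)\}_{u\ge0}$ is a family of real random variables whose laws are determined by \[ \mathbb{E}\big[e^{\mathrm{i}t\mathcal{Z}_\Psi(u)}\big]=\exp\Big(u\int_0^\infty\frac{e^{\mathrm{i}tx}-\mathrm{i}tx-1}{x^2}\,\mathrm{d}\Psi(x)\Big)\quad(t\in\mathbb{R}), \] for each real $u\ge0$ (e.g. for $\Psi=\delta_1$, $\mathcal{Z}_\Psi(u)$ is a centered Poisson variable with parameter $u$). "Uniformly in $1\le\Delta\ll B^{1-\varepsilon}$" means: for each fixed $c>0$, the ratio of the two sides tends to $1$ uniformly over $1\le\Delta\le cB(g;x)^{1-\varepsilon}$. *)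

theory Defs
  imports "HOL-Probability.Probability" "HOL-Computational_Algebra.Primes"
begin

text \<open>Additive functions live on the positive integers; the value at 0 is left unconstrained.\<close>

definition strongly_additive :: "(nat \<Rightarrow> real) \<Rightarrow> bool" where
  "strongly_additive g \<longleftrightarrow>
     (\<forall>m n. m \<ge> 1 \<and> n \<ge> 1 \<and> coprime m n \<longrightarrow> g (m * n) = g m + g n) \<and>
     (\<forall>p k. prime p \<and> k \<ge> 1 \<longrightarrow> g (p ^ k) = g p)"

definition primes_upto :: "real \<Rightarrow> nat set" where
  "primes_upto x = {p. prime p \<and> real p \<le> x}"

definition add_mean :: "(nat \<Rightarrow> real) \<Rightarrow> real \<Rightarrow> real" where
  "add_mean g x = (\<Sum>p\<in>primes_upto x. g p / real p)"

definition add_dev :: "(nat \<Rightarrow> real) \<Rightarrow> real \<Rightarrow> real" where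
  "add_dev g x = sqrt (\<Sum>p\<in>primes_upto x. (g p)\<^sup>2 / real p)"

definition upper_freq :: "(nat \<Rightarrow> real) \<Rightarrow> real \<Rightarrow> real \<Rightarrow> real" where
  "upper_freq g x \<Delta> =
     real (card {n::nat. 1 \<le> n \<and> real n \<le> x \<and> (g n - add_mean g x) / add_dev g x \<ge> \<Delta>}) / x"

text \<open>Distribution functions are right-continuous, as is \<^const>\<open>cdf\<close>; these are the
  hypotheses under which \<^const>\<open>interval_measure\<close> is the associated probability measure.\<close>

definition distribution_function :: "(real \<Rightarrow> real) \<Rightarrow> bool" where
  "distribution_function \<Psi> \<longleftrightarrow>
     mono \<Psi> \<and> (\<forall>x. continuous (at_right x) \<Psi>) \<and>
     (\<Psi> \<longlongrightarrow> 0) at_bot \<and> (\<Psi> \<longlongrightarrow> 1) at_top"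

definition delta0 :: "real \<Rightarrow> real" where
  "delta0 = cdf (return borel 0)"

text \<open>\<open>Z u\<close> has the infinitely divisible law whose Kolmogorov canonical measure is
  \<open>u d\<Psi>\<close>. If \<open>\<Psi> \<alpha> - \<Psi> 0 = 1\<close>, then \<open>d\<Psi>\<close> is carried by the half-open
  interval from \<open>0\<close> (excluded) to \<open>\<alpha>\<close>, so the integrand need not be defined at \<open>0\<close>.\<close>

definition Z_family :: "'w measure \<Rightarrow> (real \<Rightarrow> real) \<Rightarrow> (real \<Rightarrow> 'w \<Rightarrow> real) \<Rightarrow> bool" where
  "Z_family P \<Psi> Z \<longleftrightarrow>
     (\<forall>u\<ge>0. Z u \<in> borel_measurable P \<and>
        (\<forall>t::real. char (distr P borel (Z u)) t =
           exp (complex_of_real u *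
             (LINT x:{0<..}|interval_measure \<Psi>.
                (exp (\<i> * complex_of_real t * complex_of_real x)
                   - \<i> * complex_of_real t * complex_of_real x - 1) / (complex_of_real x)\<^sup>2))))"

end

theory Submission
  imports Defs "HOL-Complex_Analysis.Complex_Analysis" "HOL-Real_Asymp.Real_Asymp"
begin

text \<open>The hypothesis says that, on the scale in question, \<open>g n - add_mean g x\<close> and
  \<open>Z (B\<^sup>2)\<close>, where \<open>B = add_dev g x\<close>, have comparable upper tails at all heights from
  \<open>B\<close> to a constant times \<open>B powr (2 - \<epsilon>)\<close>. At \<open>s\<close> of order \<open>B powr (- \<epsilon>)\<close> the exponential
  moments of both variables are determined, up to constant factors, by exactly this window.
  For \<open>Z\<close>, the exponential moment is \<open>exp (B\<^sup>2 * \<Lambda> s)\<close> with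
  \<open>\<Lambda> s = (\<Sum>k. m k * s ^ (k + 2) / fact (k + 2))\<close>, \<open>m\<close> being the moments of \<open>\<Psi>\<close>; for \<open>g\<close>, an Euler
  product estimate gives the same formula, up to constant factors, with the moments of the weighted
  distribution of the \<open>g p\<close>. Hence the two functions \<open>\<Lambda>\<close> differ by \<open>O(1 / B\<^sup>2)\<close> at \<open>s = j * h\<close>,
  \<open>h = B powr (- 1 / N)\<close>, \<open>1 \<le> j \<le> N\<close>, and an \<open>N\<close>-th finite difference shows that the
  moments of order \<open>N - 2\<close> approach each other. Convergence of moments of uniformly bounded laws
  yields the convergence of distribution functions.\<close>

section \<open>Mean values of multiplicative functions\<close>

text \<open>A bounded factor in an exponential moment costs only \<open>O(1)\<close> in its
  logarithm, which is then divided by \<open>B\<^sup>2\<close>. Hence the asymptotic hypothesis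
  enters only as a comparison within a factor 2, and crude Euler product bounds suffice. The window
  comes from tilting by \<open>exp (s * X)\<close>: heights below \<open>B\<close> contribute at
  most \<open>exp (s * B)\<close>, which loses to \<open>exp (B\<^sup>2 * s\<^sup>2 / 2)\<close>
  once \<open>s * B\<close> is large, and heights above \<open>4 * s * B\<^sup>2\<close> are
  absorbed by the moment at \<open>2 * s\<close>. The difference of order \<open>N\<close> divides
  the error \<open>O(1 / B\<^sup>2)\<close> by \<open>h ^ N\<close>, so
  \<open>h ^ N * B\<^sup>2\<close> must grow, while the Taylor remainder needs \<open>h\<close> to
  tend to 0. The choice \<open>h ^ N = 1 / B\<close> meets both, so moments of higher order call for
  the hypothesis with smaller epsilon, namely \<open>1 / N\<close>. An obstacle on the probabilistic
  side is that \<open>Z\<close> is given only by its characteristic function: its real exponential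
  moments must first be shown to exist. Finite differences serve there a second time, at imaginary
  points, to bound even moments; the identity theorem then evaluates the exponential
  moments.\<close>

definition posints_upto :: "real \<Rightarrow> nat set" where
  "posints_upto x = {n. 1 \<le> n \<and> real n \<le> x}"

lemma finite_posints_upto [simp]: "finite (posints_upto x)"
  by (rule finite_subset[of _ "{..nat \<lfloor>x\<rfloor>}"]) (auto simp: posints_upto_def le_nat_floor)

lemma finite_primes_upto [simp]: "finite (primes_upto x)"
  by (rule finite_subset[of _ "{..nat \<lfloor>x\<rfloor>}"]) (auto simp: primes_upto_def le_nat_floor)

lemma prime_primes_upto: "p \<in> primes_upto x \<Longrightarrow> prime p"
  by (simp add: primes_upto_def)

section \<open>Counting multiples, and a bound of Chebyshev-Mertens type\<close>

lemma card_multiples: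
  fixes d :: nat
  assumes "d \<ge> 1" "x \<ge> 0"
  shows "card {n \<in> posints_upto x. d dvd n} = nat \<lfloor>x / real d\<rfloor>"
proof -
  have "{n \<in> posints_upto x. d dvd n} = (\<lambda>k. d * k) ` {1..nat \<lfloor>x / real d\<rfloor>}"
  proof (intro set_eqI iffI)
    fix n assume "n \<in> {n \<in> posints_upto x. d dvd n}"
    then obtain k where k: "n = d * k" "1 \<le> d * k" "real (d * k) \<le> x"
      by (auto simp: posints_upto_def)
    have "real k \<le> x / real d"
      using k assms by (simp add: field_simps)
    then have "k \<le> nat \<lfloor>x / real d\<rfloor>" by (rule le_nat_floor)
    moreover have "1 \<le> k" using k by (cases k) auto
    ultimately show "n \<in> (\<lambda>k. d * k) ` {1..nat \<lfloor>x / real d\<rfloor>}"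
      using k by auto
  next
    fix n assume "n \<in> (\<lambda>k. d * k) ` {1..nat \<lfloor>x / real d\<rfloor>}"
    then obtain k where "n = d * k" "k \<in> {1..nat \<lfloor>x / real d\<rfloor>}" by (rule imageE)
    then have k: "n = d * k" "1 \<le> k" "k \<le> nat \<lfloor>x / real d\<rfloor>" by simp_all
    have "int k \<le> \<lfloor>x / real d\<rfloor>" using k(2,3) by linarith
    then have "real k \<le> x / real d" by (simp add: le_floor_iff)
    then have "real (d * k) \<le> x" using assms by (simp add: field_simps)
    then show "n \<in> {n \<in> posints_upto x. d dvd n}"
      using k assms by (auto simp: posints_upto_def)
  qed
  moreover have "inj_on (\<lambda>k. d * k) {1..nat \<lfloor>x / real d\<rfloor>}"
    using assms by (auto simp: inj_on_def)
  ultimately show ?thesis by (simp add: card_image)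
qed

lemma card_multiples_le:
  fixes d :: nat
  assumes "d \<ge> 1" "x \<ge> 0"
  shows "real (card {n \<in> posints_upto x. d dvd n}) \<le> x / real d"
  using assms by (simp add: card_multiples)

lemma card_multiples_ge:
  fixes d :: nat
  assumes "d \<ge> 1" "real d \<le> x"
  shows "x / (2 * real d) \<le> real (card {n \<in> posints_upto x. d dvd n})"
proof -
  have "1 \<le> x / real d" using assms by (simp add: field_simps)
  then have "(1::real) \<le> of_int \<lfloor>x / real d\<rfloor>" by (simp del: of_int_1 add: le_floor_iff)
  moreover have "x / real d < of_int \<lfloor>x / real d\<rfloor> + 1" using floor_correct[of "x / real d"] by simp
  ultimately have "x / real d \<le> 2 * of_int \<lfloor>x / real d\<rfloor>" by linarith
  moreover have "real (card {n \<in> posints_upto x. d dvd n}) = of_int \<lfloor>x / real d\<rfloor>"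
    using assms by (simp add: card_multiples)
  ultimately show ?thesis by (simp add: field_simps)
qed

lemma prod_primes_dvd_iff:
  fixes D :: "nat set"
  assumes "finite D" "\<And>p. p \<in> D \<Longrightarrow> prime p"
  shows "\<Prod>D dvd n \<longleftrightarrow> (\<forall>p\<in>D. p dvd n)"
  using assms
proof (induction D rule: finite_induct)
  case (insert p D)
  have "coprime p (\<Prod>D)"
    using insert by (intro prod_coprime_right) (metis insertCI primes_coprime)
  then have "p * \<Prod>D dvd n \<longleftrightarrow> p dvd n \<and> \<Prod>D dvd n"
    by (meson divides_mult dvd_mult_left dvd_mult_right)
  with insert show ?case by auto
qed auto

text \<open>Each prime \<open>p \<le> x\<close> has at least \<open>x / (2 * p)\<close> multiples up
  to \<open>x\<close>. Count pairs of a prime and a multiple \<open>n\<close> of it with weight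
  \<open>ln p\<close>: for fixed \<open>n\<close> the distinct primes dividing \<open>n\<close> have
  product at most \<open>n\<close>, so their logarithms add up to at most \<open>ln x\<close>. This
  is the only information on the distribution of primes that the Euler product estimates
  use.\<close>

lemma sum_ln_primes_div_le:
  assumes "x \<ge> 1"
  shows "(\<Sum>p\<in>primes_upto x. ln (real p) / real p) \<le> 2 * ln x"
proof -
  have "x / 2 * (\<Sum>p\<in>primes_upto x. ln (real p) / real p) =
      (\<Sum>p\<in>primes_upto x. x / (2 * real p) * ln (real p))"
    by (simp add: sum_distrib_left field_simps)
  also have "\<dots> \<le> (\<Sum>p\<in>primes_upto x. real (card {n \<in> posints_upto x. p dvd n}) * ln (real p))"
    using prime_ge_1_nat
    by (intro sum_mono mult_right_mono card_multiples_ge) (auto simp: primes_upto_def)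
  also have "\<dots> = (\<Sum>p\<in>primes_upto x. \<Sum>n\<in>posints_upto x. if p dvd n then ln (real p) else 0)"
    by (simp add: sum.If_cases Int_def)
  also have "\<dots> = (\<Sum>n\<in>posints_upto x. \<Sum>p\<in>primes_upto x. if p dvd n then ln (real p) else 0)"
    by (rule sum.swap)
  also have "\<dots> \<le> (\<Sum>n\<in>posints_upto x. ln x)"
  proof (rule sum_mono)
    fix n assume n: "n \<in> posints_upto x"
    define D where "D = {p \<in> primes_upto x. p dvd n}"
    have D: "finite D" unfolding D_def by simp
    have D': "\<And>p. p \<in> D \<Longrightarrow> prime p" by (simp add: D_def primes_upto_def)
    have "\<Prod>D dvd n" using D D' by (subst prod_primes_dvd_iff) (simp_all add: D_def)
    then have le: "\<Prod>D \<le> n" using n by (auto simp: posints_upto_def intro: dvd_imp_le)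
    have pos: "p > 0" if "p \<in> D" for p using D'[OF that] by (simp add: prime_gt_0_nat)
    have "(\<Sum>p\<in>primes_upto x. if p dvd n then ln (real p) else 0) = (\<Sum>p\<in>D. ln (real p))"
      unfolding D_def by (simp add: sum.inter_filter)
    also have "\<dots> = ln (real (\<Prod>D))"
      using D pos by (simp add: ln_prod)
    also have "\<dots> \<le> ln x"
    proof (rule ln_mono)
      show "real (\<Prod>D) \<le> x" using le n by (simp add: posints_upto_def del: of_nat_prod)
      show "0 < real (\<Prod>D)" using pos by (simp add: prod_pos del: of_nat_prod)
    qed
    finally show "(\<Sum>p\<in>primes_upto x. if p dvd n then ln (real p) else 0) \<le> ln x" .
  qed
  also have "\<dots> = real (card (posints_upto x)) * ln x" by simp
  also have "\<dots> \<le> x * ln x"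
    using card_multiples_le[of 1 x] assms by (intro mult_right_mono) auto
  finally show ?thesis using assms by (simp add: field_simps)
qed

section \<open>Sums over squarefree divisors and Euler products\<close>

lemma strongly_additive_eq_sum:
  assumes "strongly_additive g" "n \<ge> 1"
  shows "g n = (\<Sum>p\<in>prime_factors n. g p)"
proof -
  have cop: "g (a * b) = g a + g b" if "a \<ge> 1" "b \<ge> 1" "coprime a b" for a b
    using assms that by (auto simp: strongly_additive_def)
  have pow: "g (p ^ k) = g p" if "prime p" "k \<ge> 1" for p k
    using assms that by (auto simp: strongly_additive_def)
  have "g 1 = 0" using cop[of 1 1] by simp
  have *: "g (\<Prod>p\<in>D. p ^ k p) = (\<Sum>p\<in>D. g p)"
    if "finite D" "\<And>p. p \<in> D \<Longrightarrow> prime p \<and> k p \<ge> 1" for D and k :: "nat \<Rightarrow> nat"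
    using that
  proof (induction D rule: finite_induct)
    case (insert p D)
    have "coprime (p ^ k p) (\<Prod>p\<in>D. p ^ k p)"
      using insert by (intro prod_coprime_right) (metis coprime_power_left_iff
          coprime_power_right_iff insertCI primes_coprime)
    moreover have "1 \<le> p ^ k p" using insert.prems[of p] prime_gt_0_nat[of p] by simp
    moreover have "1 \<le> (\<Prod>p\<in>D. p ^ k p)"
      using insert.prems prime_gt_0_nat by (simp add: Suc_le_eq prod_pos)
    ultimately show ?case using insert pow[of p "k p"] cop by simp
  qed (use \<open>g 1 = 0\<close> in simp)
  have "n = (\<Prod>p\<in>prime_factors n. p ^ multiplicity p n)"
    using assms by (simp add: prime_factorization_nat)
  then have "g n = g (\<Prod>p\<in>prime_factors n. p ^ multiplicity p n)" by simp
  also have "\<dots> = (\<Sum>p\<in>prime_factors n. g p)"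
  proof (rule *)
    show "prime p \<and> 1 \<le> multiplicity p n" if "p \<in> prime_factors n" for p
      using that by (simp add: prime_factors_multiplicity Suc_le_eq)
  qed simp
  finally show ?thesis .
qed

text \<open>Expanding the product gives one term for each set \<open>D\<close> of primes dividing
  \<open>n\<close>. Such a set stands for the squarefree divisor \<open>\<Prod>D\<close>, and
  exchanging the two sums leaves the number of its multiples.\<close>

lemma sum_prod_prime_factors:
  fixes h :: "nat \<Rightarrow> real"
  shows "(\<Sum>n\<in>posints_upto x. \<Prod>p\<in>prime_factors n. (1 + h p)) =
    (\<Sum>D\<in>Pow (primes_upto x). prod h D * real (card {n \<in> posints_upto x. \<Prod>D dvd n}))"
proof -
  have "(\<Prod>p\<in>prime_factors n. (1 + h p)) =
      (\<Sum>D\<in>Pow (primes_upto x). if \<Prod>D dvd n then prod h D else 0)"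
    if n: "n \<in> posints_upto x" for n
  proof -
    have "(\<Prod>p\<in>prime_factors n. (1 + h p)) = (\<Sum>D\<in>Pow (prime_factors n). prod h D)"
      using prod_add[of "prime_factors n" h "\<lambda>_. 1"] by (simp add: add.commute)
    also have "Pow (prime_factors n) = {D \<in> Pow (primes_upto x). \<Prod>D dvd n}"
    proof (intro set_eqI iffI)
      fix D assume "D \<in> Pow (prime_factors n)"
      then have D: "D \<subseteq> prime_factors n" by simp
      have "D \<subseteq> primes_upto x"
      proof
        fix p assume "p \<in> D"
        then have "p \<in> prime_factors n" using D by blast
        then have "prime p" "p \<le> n" using n
          by (auto simp: posints_upto_def intro!: dvd_imp_le)
        then show "p \<in> primes_upto x" using n by (simp add: primes_upto_def posints_upto_def)
      qed
      moreover have "\<Prod>D dvd n"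
      proof (subst prod_primes_dvd_iff)
        show "finite D" using D by (rule finite_subset) simp
      qed (use D in auto)
      ultimately show "D \<in> {D \<in> Pow (primes_upto x). \<Prod>D dvd n}" by simp
    next
      fix D assume "D \<in> {D \<in> Pow (primes_upto x). \<Prod>D dvd n}"
      then have D: "D \<subseteq> primes_upto x" "\<Prod>D dvd n" by auto
      have fin: "finite D" using D(1) by (rule finite_subset) simp
      have pr: "prime p" if "p \<in> D" for p using D(1) that by (auto simp: primes_upto_def)
      have "p dvd n" if "p \<in> D" for p
        using D(2) that prod_primes_dvd_iff[OF fin pr] by blast
      with pr n show "D \<in> Pow (prime_factors n)"
        by (auto simp: prime_factors_dvd posints_upto_def)
    qed
    also have "(\<Sum>D | D \<in> Pow (primes_upto x) \<and> \<Prod>D dvd n. prod h D) =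
      (\<Sum>D\<in>Pow (primes_upto x). if \<Prod>D dvd n then prod h D else 0)"
      by (rule sum.inter_filter) simp
    finally show ?thesis .
  qed
  then have "(\<Sum>n\<in>posints_upto x. \<Prod>p\<in>prime_factors n. (1 + h p)) =
    (\<Sum>n\<in>posints_upto x. \<Sum>D\<in>Pow (primes_upto x). if \<Prod>D dvd n then prod h D else 0)"
    by (rule sum.cong[OF refl])
  also have "\<dots> = (\<Sum>D\<in>Pow (primes_upto x). \<Sum>n\<in>posints_upto x. if \<Prod>D dvd n then prod h D else 0)"
    by (rule sum.swap)
  finally show ?thesis
    by (simp add: sum.If_cases Int_def mult.commute)
qed

lemma prod_one_plus_primes_upto:
  fixes h :: "nat \<Rightarrow> real"
  shows "(\<Prod>p\<in>primes_upto x. 1 + h p / real p) =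
    (\<Sum>D\<in>Pow (primes_upto x). prod h D / real (\<Prod>D))"
  using prod_add[of "primes_upto x" "\<lambda>p. h p / real p" "\<lambda>_. 1"]
  by (simp add: add.commute prod_dividef)

lemma prod_primes_ge_1: "D \<subseteq> primes_upto x \<Longrightarrow> \<Prod>D \<ge> 1"
  using prime_gt_0_nat by (auto simp: Suc_le_eq primes_upto_def intro!: prod_pos)

text \<open>With \<open>h\<close> nonnegative, each count of multiples may be replaced by
  \<open>x / \<Prod>D\<close>; the sum over all \<open>D\<close> then factors as an Euler product,
  and \<open>1 + y \<le> exp y\<close> finishes.\<close>

lemma sum_mult_fun_le:
  fixes h :: "nat \<Rightarrow> real"
  assumes h: "\<And>p. prime p \<Longrightarrow> 0 \<le> h p" and "x \<ge> 0"
  shows "(\<Sum>n\<in>posints_upto x. \<Prod>p\<in>prime_factors n. (1 + h p)) \<le>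
    x * exp (\<Sum>p\<in>primes_upto x. h p / real p)"
proof -
  have "(\<Sum>n\<in>posints_upto x. \<Prod>p\<in>prime_factors n. (1 + h p)) \<le>
      (\<Sum>D\<in>Pow (primes_upto x). prod h D * (x / real (\<Prod>D)))"
    unfolding sum_prod_prime_factors using prod_primes_ge_1 assms
    by (intro sum_mono mult_left_mono card_multiples_le prod_nonneg) (auto simp: primes_upto_def)
  also have "\<dots> = x * (\<Prod>p\<in>primes_upto x. 1 + h p / real p)"
    unfolding prod_one_plus_primes_upto by (simp add: sum_distrib_left field_simps)
  also have "\<dots> \<le> x * (\<Prod>p\<in>primes_upto x. exp (h p / real p))"
    using assms by (intro mult_left_mono prod_mono) (auto simp: primes_upto_def)
  finally show ?thesis by (simp add: exp_sum)
qed

lemma exp_diff_square_le: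
  fixes y :: real
  assumes "y \<ge> 0"
  shows "exp (y - y\<^sup>2) \<le> 1 + y"
proof (cases "y \<le> 1")
  case True
  then have "exp (y - y\<^sup>2) \<le> exp (ln (1 + y))"
    using ln_one_plus_pos_lower_bound[of y] assms by (subst exp_le_cancel_iff)
  then show ?thesis using assms by simp
next
  case False
  then have "y - y\<^sup>2 \<le> 0" by (simp add: power2_eq_square)
  then have "exp (y - y\<^sup>2) \<le> 1" by simp
  then show ?thesis using assms by linarith
qed

text \<open>Only divisors built from primes up to a small power \<open>z\<close> of \<open>x\<close> are kept.
  By Rankin's trick, those exceeding \<open>x\<close> contribute at most half of the Euler product.\<close>

lemma sum_mult_fun_ge:
  fixes H :: real
  assumes "H \<ge> 0"
  obtains c X where "c > 0"
    "\<And>x h. x \<ge> X \<Longrightarrow> (\<And>p. prime p \<Longrightarrow> 0 \<le> h p \<and> h p \<le> H) \<Longrightarrow>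
      c * x * exp (\<Sum>p\<in>primes_upto x. h p / real p)
        \<le> (\<Sum>n\<in>posints_upto x. \<Prod>p\<in>prime_factors n. (1 + h p))"
proof
  \<comment> \<open>Rankin's trick will gain \<open>exp (- K)\<close> and lose
    \<open>exp (4 * H)\<close>; the extra 1 leaves the factor
    \<open>exp (- 1) \<le> 1 / 2\<close>.\<close>
  define K where "K = 4 * H + 1"
  define C where "C = (\<Sum>n. 1 / (real n)\<^sup>2)"
  \<comment> \<open>The term \<open>H\<^sup>2 * C\<close> pays for replacing \<open>1 + y\<close> by
    \<open>exp y\<close> in the product, \<open>2 * H * K\<close> for the primes between
    \<open>z\<close> and \<open>x\<close>; \<open>1 / 4\<close> is one half from rounding in the
    counts times one half from the large divisors.\<close>
  define c where "c = exp (- (H\<^sup>2 * C) - 2 * H * K) / 4"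
  show "c > 0" by (simp add: c_def)
  fix x :: real and h :: "nat \<Rightarrow> real"
  assume xX: "x \<ge> exp K" and "\<And>p. prime p \<Longrightarrow> 0 \<le> h p \<and> h p \<le> H"
  then have h: "0 \<le> h p" "h p \<le> H" if "prime p" for p using that by auto
  have K: "K \<ge> 1" using assms by (simp add: K_def)
  have x: "x > 1" using xX K by (meson exp_gt_one less_le_trans zero_less_one)
  have L: "ln x \<ge> K" using xX x by (simp add: ln_ge_iff)
  define z where "z = x powr (1 / K)"
  have lnz: "ln z = ln x / K" using x by (simp add: z_def ln_powr)
  have lnz1: "ln z \<ge> 1" using L K by (simp add: lnz field_simps)
  have z1: "z \<ge> 1"
    unfolding z_def using x K by (simp add: ge_one_powr_ge_zero)
  have "z \<le> x powr 1" unfolding z_def using x K by (intro powr_mono) auto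
  then have zx: "z \<le> x" using x by simp
  \<comment> \<open>This exponent balances two needs: \<open>p powr \<delta>\<close> stays below
    \<open>exp 1\<close> for every prime up to \<open>z\<close>, whereas
    \<open>x powr \<delta>\<close> is the full gain \<open>exp K\<close>.\<close>
  define \<delta> where "\<delta> = 1 / ln z"
  have \<delta>0: "\<delta> > 0" using lnz1 by (simp add: \<delta>_def)
  have \<delta>: "x powr \<delta> = exp K" using x K L by (simp add: powr_def \<delta>_def lnz)
  define Q where "Q = (\<Prod>p\<in>primes_upto z. 1 + h p / real p)"
  have Qpos: "Q > 0"
    unfolding Q_def using h by (intro prod_pos) (auto simp: primes_upto_def add_pos_nonneg)
  have sub: "primes_upto z \<subseteq> primes_upto x" using zx by (auto simp: primes_upto_def)
  have hD: "0 \<le> prod h D" if "D \<subseteq> primes_upto z" for D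
    using that h by (intro prod_nonneg) (auto simp: primes_upto_def)
  have ppos: "0 < p" if "p \<in> primes_upto y" for p y
    using that by (auto simp: primes_upto_def prime_gt_0_nat)

  define T where "T = (\<Sum>D | D \<in> Pow (primes_upto z) \<and> real (\<Prod>D) > x. prod h D / real (\<Prod>D))"
  have "T \<le> (\<Sum>D | D \<in> Pow (primes_upto z) \<and> real (\<Prod>D) > x.
      exp (- K) * (\<Prod>p\<in>D. h p * real p powr \<delta> / real p))"
    unfolding T_def
  proof (rule sum_mono)
    fix D assume "D \<in> {D. D \<in> Pow (primes_upto z) \<and> real (\<Prod>D) > x}"
    then have D: "D \<subseteq> primes_upto z" "real (\<Prod>D) > x" by auto
    have "x powr \<delta> \<le> real (\<Prod>D) powr \<delta>" using D x \<delta>0 by (intro powr_mono2) auto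
    then have "1 \<le> exp (- K) * real (\<Prod>D) powr \<delta>"
      unfolding \<delta> by (simp add: exp_minus field_simps)
    also have "real (\<Prod>D) powr \<delta> = (\<Prod>p\<in>D. real p powr \<delta>)"
      by (simp add: prod_powr_distrib)
    finally have "prod h D / real (\<Prod>D) * 1 \<le>
        prod h D / real (\<Prod>D) * (exp (- K) * (\<Prod>p\<in>D. real p powr \<delta>))"
      using hD[OF D(1)] by (intro mult_left_mono divide_nonneg_nonneg of_nat_0_le_iff)
    also have "\<dots> = exp (- K) * (\<Prod>p\<in>D. h p * real p powr \<delta> / real p)"
      by (simp add: prod_dividef prod.distrib)
    finally show "prod h D / real (\<Prod>D) \<le> exp (- K) * (\<Prod>p\<in>D. h p * real p powr \<delta> / real p)"
      by simp
  qed
  also have "\<dots> \<le> (\<Sum>D\<in>Pow (primes_upto z). exp (- K) * (\<Prod>p\<in>D. h p * real p powr \<delta> / real p))"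
    using h by (intro sum_mono2 mult_nonneg_nonneg prod_nonneg) (auto simp: prime_primes_upto)
  also have "\<dots> = exp (- K) * (\<Prod>p\<in>primes_upto z. 1 + h p * real p powr \<delta> / real p)"
    using prod_one_plus_primes_upto[of "\<lambda>p. h p * real p powr \<delta>" z]
    by (simp add: sum_distrib_left prod_dividef)
  also have "\<dots> \<le> exp (- K) * (\<Prod>p\<in>primes_upto z. (1 + h p / real p) *
      exp (2 * H * \<delta> * (ln (real p) / real p)))"
  proof (intro mult_left_mono prod_mono conjI)
    fix p assume p: "p \<in> primes_upto z"
    then have pr: "prime p" "real p \<le> z" by (auto simp: primes_upto_def)
    have p2: "real p \<ge> 2" using prime_ge_2_nat[OF pr(1)] by simp
    show "0 \<le> 1 + h p * real p powr \<delta> / real p" using h(1)[OF pr(1)] by simp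
    \<comment> \<open>Since \<open>p \<le> z\<close>, this lies between 0 and 1, where
      \<open>exp y \<le> 1 + 2 * y\<close>. The cost of the weight is thus linear in
      \<open>ln p / p\<close>, which \<open>sum_ln_primes_div_le\<close> can sum.\<close>
    define y where "y = \<delta> * ln (real p)"
    have y0: "0 \<le> y" using p2 \<delta>0 by (simp add: y_def)
    have "ln (real p) \<le> ln z" using pr p2 z1 by simp
    then have y1: "y \<le> 1" using lnz1 by (simp add: y_def \<delta>_def)
    have "exp y \<le> 1 + y + y\<^sup>2" using y0 y1 by (rule exp_bound)
    also have "\<dots> \<le> 1 + 2 * y" using y0 y1 by (simp add: power2_eq_square mult_left_le)
    finally have e: "exp y \<le> 1 + 2 * y" .
    have "real p powr \<delta> = exp y" using p2 by (simp add: powr_def y_def mult.commute)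
    then have "1 + h p * real p powr \<delta> / real p \<le> 1 + h p * (1 + 2 * y) / real p"
      using e h(1)[OF pr(1)] p2 by (simp add: divide_right_mono mult_left_mono)
    also have "\<dots> = (1 + h p / real p) + h p * (2 * y / real p)"
      by (simp add: algebra_simps add_divide_distrib)
    also have "\<dots> \<le> (1 + h p / real p) + H * (2 * y / real p)"
      using h(2)[OF pr(1)] y0 by (intro add_left_mono mult_right_mono) auto
    also have "\<dots> \<le> (1 + h p / real p) + (1 + h p / real p) * (H * (2 * y / real p))"
    proof -
      have "1 * (H * (2 * y / real p)) \<le> (1 + h p / real p) * (H * (2 * y / real p))"
        using y0 assms h(1)[OF pr(1)] by (intro mult_right_mono mult_nonneg_nonneg) auto
      then show ?thesis by simp
    qed
    also have "\<dots> = (1 + h p / real p) * (1 + 2 * H * \<delta> * (ln (real p) / real p))"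
      by (simp add: y_def field_simps)
    also have "\<dots> \<le> (1 + h p / real p) * exp (2 * H * \<delta> * (ln (real p) / real p))"
      using h(1)[OF pr(1)] by (intro mult_left_mono) auto
    finally show "1 + h p * real p powr \<delta> / real p \<le>
      (1 + h p / real p) * exp (2 * H * \<delta> * (ln (real p) / real p))" .
  qed auto
  also have "\<dots> = exp (- K) * Q * exp (2 * H * \<delta> * (\<Sum>p\<in>primes_upto z. ln (real p) / real p))"
    by (simp add: prod.distrib Q_def exp_sum sum_distrib_left)
  also have "\<dots> \<le> exp (- K) * Q * exp (4 * H)"
  proof (intro mult_left_mono)
    have "2 * H * \<delta> * (\<Sum>p\<in>primes_upto z. ln (real p) / real p) \<le> 2 * H * \<delta> * (2 * ln z)"
      using assms \<delta>0 sum_ln_primes_div_le[OF z1] by (intro mult_left_mono) auto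
    also have "\<dots> = 4 * H" using lnz1 by (simp add: \<delta>_def)
    finally show "exp (2 * H * \<delta> * (\<Sum>p\<in>primes_upto z. ln (real p) / real p)) \<le> exp (4 * H)"
      by simp
  qed (use Qpos in auto)
  also have "\<dots> = exp (- 1) * Q" by (simp add: K_def exp_add[symmetric])
  also have "\<dots> \<le> Q / 2"
    using Qpos exp_ge_add_one_self[of 1] by (simp add: exp_minus field_simps)
  finally have T: "T \<le> Q / 2" .

  have "x * Q / 4 \<le> x / 2 * (Q - T)" using T x by (simp add: field_simps)
  also have "Q - T = (\<Sum>D | D \<in> Pow (primes_upto z) \<and> real (\<Prod>D) \<le> x. prod h D / real (\<Prod>D))"
  proof -
    have "Q = (\<Sum>D\<in>{D. D \<in> Pow (primes_upto z) \<and> real (\<Prod>D) > x} \<union>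
        {D. D \<in> Pow (primes_upto z) \<and> real (\<Prod>D) \<le> x}. prod h D / real (\<Prod>D))"
      unfolding Q_def prod_one_plus_primes_upto by (intro sum.cong) auto
    also have "\<dots> = T + (\<Sum>D | D \<in> Pow (primes_upto z) \<and> real (\<Prod>D) \<le> x. prod h D / real (\<Prod>D))"
      unfolding T_def by (intro sum.union_disjoint) auto
    finally show ?thesis by simp
  qed
  also have "x / 2 * \<dots> =
      (\<Sum>D | D \<in> Pow (primes_upto z) \<and> real (\<Prod>D) \<le> x. prod h D * (x / (2 * real (\<Prod>D))))"
    by (simp add: sum_distrib_left field_simps)
  also have "\<dots> \<le> (\<Sum>D | D \<in> Pow (primes_upto z) \<and> real (\<Prod>D) \<le> x.
      prod h D * real (card {n \<in> posints_upto x. \<Prod>D dvd n}))"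
    using hD prod_primes_ge_1 by (intro sum_mono mult_left_mono card_multiples_ge) auto
  also have "\<dots> \<le> (\<Sum>D\<in>Pow (primes_upto x). prod h D * real (card {n \<in> posints_upto x. \<Prod>D dvd n}))"
    using sub h
    by (intro sum_mono2 mult_nonneg_nonneg prod_nonneg) (auto simp: prime_primes_upto)
  finally have main: "x * Q / 4 \<le> (\<Sum>n\<in>posints_upto x. \<Prod>p\<in>prime_factors n. (1 + h p))"
    unfolding sum_prod_prime_factors .

  have sq: "(\<Sum>p\<in>primes_upto z. (h p / real p)\<^sup>2) \<le> H\<^sup>2 * C"
  proof -
    have sm: "summable (\<lambda>n. 1 / (real n)\<^sup>2)"
      using inverse_power_summable[of 2, where 'a = real] by (simp add: inverse_eq_divide)
    have "(\<Sum>p\<in>primes_upto z. (h p / real p)\<^sup>2) \<le> (\<Sum>p\<in>primes_upto z. H\<^sup>2 * (1 / (real p)\<^sup>2))"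
      using h by (intro sum_mono)
        (auto simp: power_divide primes_upto_def intro!: divide_right_mono power_mono)
    also have "\<dots> = H\<^sup>2 * (\<Sum>p\<in>primes_upto z. 1 / (real p)\<^sup>2)" by (simp add: sum_distrib_left)
    also have "\<dots> \<le> H\<^sup>2 * C"
      unfolding C_def by (intro mult_left_mono sum_le_suminf sm) auto
    finally show ?thesis .
  qed
  \<comment> \<open>Beyond \<open>z\<close> one has \<open>1 \<le> \<delta> * ln p\<close>;
    inserting this factor reduces the sum to the logarithmic one, and \<open>ln x / ln z = K\<close>
    keeps the result bounded.\<close>
  have tail: "(\<Sum>p\<in>primes_upto x - primes_upto z. h p / real p) \<le> 2 * H * K"
  proof -
    have "(\<Sum>p\<in>primes_upto x - primes_upto z. h p / real p) \<le>
        (\<Sum>p\<in>primes_upto x - primes_upto z. H * \<delta> * (ln (real p) / real p))"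
    proof (rule sum_mono)
      fix p assume "p \<in> primes_upto x - primes_upto z"
      then have p: "prime p" "z < real p" by (auto simp: primes_upto_def)
      have "ln z \<le> ln (real p)" using p z1 by simp
      then have "1 \<le> \<delta> * ln (real p)" using lnz1 by (simp add: \<delta>_def)
      then have "h p * 1 \<le> H * (\<delta> * ln (real p))" using h[OF p(1)] assms by (intro mult_mono) auto
      then have "h p / real p \<le> H * (\<delta> * ln (real p)) / real p" by (intro divide_right_mono) auto
      then show "h p / real p \<le> H * \<delta> * (ln (real p) / real p)" by (simp add: field_simps)
    qed
    also have "\<dots> \<le> (\<Sum>p\<in>primes_upto x. H * \<delta> * (ln (real p) / real p))"
      using assms \<delta>0 ppos by (intro sum_mono2) (auto intro!: mult_nonneg_nonneg simp: Suc_le_eq)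
    also have "\<dots> = H * \<delta> * (\<Sum>p\<in>primes_upto x. ln (real p) / real p)" by (simp add: sum_distrib_left)
    also have "\<dots> \<le> H * \<delta> * (2 * ln x)"
      using assms \<delta>0 x by (intro mult_left_mono sum_ln_primes_div_le) auto
    also have "\<dots> = 2 * H * K" using x K L by (simp add: \<delta>_def lnz)
    finally show ?thesis .
  qed
  have "(\<Sum>p\<in>primes_upto x. h p / real p) =
      (\<Sum>p\<in>primes_upto x - primes_upto z. h p / real p) + (\<Sum>p\<in>primes_upto z. h p / real p)"
    using sub by (intro sum.subset_diff) auto
  then have "(\<Sum>p\<in>primes_upto x. h p / real p) - H\<^sup>2 * C - 2 * H * K
      \<le> (\<Sum>p\<in>primes_upto z. h p / real p - (h p / real p)\<^sup>2)"
    using sq tail by (simp add: sum_subtractf)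
  then have "exp ((\<Sum>p\<in>primes_upto x. h p / real p) - H\<^sup>2 * C - 2 * H * K) \<le>
      (\<Prod>p\<in>primes_upto z. exp (h p / real p - (h p / real p)\<^sup>2))"
    by (simp flip: exp_sum)
  also have "\<dots> \<le> Q"
    unfolding Q_def using h by (intro prod_mono) (auto intro!: exp_diff_square_le simp: primes_upto_def)
  finally have "c * exp (\<Sum>p\<in>primes_upto x. h p / real p) \<le> Q / 4"
    by (simp add: c_def exp_diff exp_add exp_minus field_simps)
  then have "x * (c * exp (\<Sum>p\<in>primes_upto x. h p / real p)) \<le> x * (Q / 4)"
    using x by (intro mult_left_mono) auto
  with main show "c * x * exp (\<Sum>p\<in>primes_upto x. h p / real p)
        \<le> (\<Sum>n\<in>posints_upto x. \<Prod>p\<in>prime_factors n. (1 + h p))"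
    by (simp add: mult_ac)
qed

section \<open>Finite differences and entire characteristic functions\<close>

text \<open>Pascal's rule: a difference of order \<open>N + 1\<close> is a difference of order
  \<open>N\<close> applied to first differences.\<close>

lemma alternating_binomial_sum_Suc:
  fixes f :: "nat \<Rightarrow> 'a::comm_ring_1"
  shows "(\<Sum>k\<le>Suc N. (-1) ^ k * of_nat (Suc N choose k) * f k) =
    (\<Sum>k\<le>N. (-1) ^ k * of_nat (N choose k) * (f k - f (Suc k)))"
proof -
  have "(\<Sum>k\<le>N. (-1) ^ k * of_nat (N choose k) * f k) =
      (\<Sum>k\<le>Suc N. (-1) ^ k * of_nat (N choose k) * f k)"
    by (simp add: binomial_eq_0)
  also have "\<dots> = f 0 - (\<Sum>k\<le>N. (-1) ^ k * of_nat (N choose Suc k) * f (Suc k))"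
    by (subst sum.atMost_Suc_shift) (simp add: sum_negf binomial_eq_0)
  finally have *: "(\<Sum>k\<le>N. (-1) ^ k * of_nat (N choose k) * f k) = \<dots>" .
  have "(\<Sum>k\<le>Suc N. (-1) ^ k * of_nat (Suc N choose k) * f k) =
      f 0 - (\<Sum>k\<le>N. (-1) ^ k * of_nat (N choose Suc k) * f (Suc k))
          - (\<Sum>k\<le>N. (-1) ^ k * of_nat (N choose k) * f (Suc k))"
    by (subst sum.atMost_Suc_shift) (simp add: sum_negf sum.distrib sum_subtractf algebra_simps)
  then show ?thesis
    unfolding *[symmetric] by (simp add: sum_subtractf algebra_simps)
qed

text \<open>A first difference lowers the degree of a polynomial by one and multiplies the leading
  coefficient by the degree, up to sign. The shift \<open>c\<close> allows both central and forward
  differences later.\<close>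

lemma alternating_binomial_sum_power:
  fixes c :: "'a::real_normed_field"
  assumes "j \<le> N"
  shows "(\<Sum>k\<le>N. (-1) ^ k * of_nat (N choose k) * (c + of_nat k) ^ j) =
    (if j = N then (-1) ^ N * fact N else 0)"
  using assms
proof (induction N arbitrary: j)
  case (Suc N)
  have diff: "(c + of_nat k) ^ j - (c + of_nat (Suc k)) ^ j =
      - (\<Sum>i<j. of_nat (j choose i) * (c + of_nat k) ^ i)" for k
  proof -
    have "(c + of_nat (Suc k)) ^ j = (\<Sum>i\<le>j. of_nat (j choose i) * (c + of_nat k) ^ i)"
      using binomial_ring[of "c + of_nat k" 1 j] by (simp add: add_ac)
    then show ?thesis by (simp flip: lessThan_Suc_atMost)
  qed
  have "(\<Sum>k\<le>Suc N. (-1) ^ k * of_nat (Suc N choose k) * (c + of_nat k) ^ j) =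
      - (\<Sum>k\<le>N. \<Sum>i<j. of_nat (j choose i) * ((-1) ^ k * of_nat (N choose k) * (c + of_nat k) ^ i))"
    unfolding alternating_binomial_sum_Suc diff by (simp add: sum_negf sum_distrib_left mult_ac)
  also have "\<dots> = - (\<Sum>i<j. of_nat (j choose i) *
      (\<Sum>k\<le>N. (-1) ^ k * of_nat (N choose k) * (c + of_nat k) ^ i))"
    by (subst sum.swap) (simp add: sum_distrib_left)
  also have "\<dots> = - (\<Sum>i<j. of_nat (j choose i) * (if i = N then (-1) ^ N * fact N else 0))"
    using Suc.prems by (intro arg_cong[where f = uminus] sum.cong refl) (subst Suc.IH, auto)
  also have "\<dots> = (if j = Suc N then (-1) ^ Suc N * fact (Suc N) else 0)"
    using Suc.prems by (auto simp: sum.delta if_distrib[of "\<lambda>x. _ * x"] algebra_simps cong: if_cong)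
  finally show ?case .
qed simp

lemma norm_le_of_norm_diff_le: "norm (x - y) \<le> e \<Longrightarrow> norm x \<le> norm y + e"
  using norm_triangle_sub[of x y] by linarith

text \<open>The difference of the approximating polynomial is exactly its top term, and errors at
  the nodes are amplified by at most the sum of the binomial coefficients. It is applied with
  central nodes to characteristic functions and with \<open>c = 0\<close> to cumulants.\<close>

lemma finite_difference_coefficient:
  fixes f :: "nat \<Rightarrow> 'a::real_normed_field"
  assumes "\<And>k. k \<le> N \<Longrightarrow> norm (f k - (\<Sum>j\<le>N. a j * ((c + of_nat k) * h) ^ j)) \<le> C"
  shows "norm ((\<Sum>k\<le>N. (-1) ^ k * of_nat (N choose k) * f k) - (-1) ^ N * fact N * a N * h ^ N)
    \<le> 2 ^ N * C"
proof -
  define P where "P k = (\<Sum>j\<le>N. a j * ((c + of_nat k) * h) ^ j)" for k :: nat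
  have "(\<Sum>k\<le>N. (-1) ^ k * of_nat (N choose k) * P k) =
      (\<Sum>k\<le>N. \<Sum>j\<le>N. a j * h ^ j * ((-1) ^ k * of_nat (N choose k) * (c + of_nat k) ^ j))"
    unfolding P_def by (simp add: sum_distrib_left power_mult_distrib mult_ac)
  also have "\<dots> = (\<Sum>j\<le>N. a j * h ^ j *
      (\<Sum>k\<le>N. (-1) ^ k * of_nat (N choose k) * (c + of_nat k) ^ j))"
    by (subst sum.swap) (simp add: sum_distrib_left)
  also have "\<dots> = (\<Sum>j\<le>N. a j * h ^ j * (if j = N then (-1) ^ N * fact N else 0))"
    by (intro sum.cong refl) (simp add: alternating_binomial_sum_power)
  also have "\<dots> = (-1) ^ N * fact N * a N * h ^ N"
    by (simp add: sum.delta if_distrib[of "\<lambda>x. _ * x"] mult_ac cong: if_cong)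
  finally have "(\<Sum>k\<le>N. (-1) ^ k * of_nat (N choose k) * f k) - (-1) ^ N * fact N * a N * h ^ N =
      (\<Sum>k\<le>N. (-1) ^ k * of_nat (N choose k) * (f k - P k))"
    by (simp add: sum_subtractf algebra_simps)
  also have "norm \<dots> \<le> (\<Sum>k\<le>N. real (N choose k) * C)"
    using assms by (intro sum_norm_le)
      (auto simp: norm_mult norm_power P_def intro!: mult_left_mono)
  also have "\<dots> = 2 ^ N * C"
    using choose_row_sum[of N] by (simp flip: sum_distrib_right of_nat_sum)
  finally show ?thesis .
qed

section \<open>From characteristic functions to exponential moments\<close>

lemma power_series_remainder_le:
  fixes a :: "nat \<Rightarrow> 'a::{real_normed_field,banach}"
  assumes a: "summable (\<lambda>j. norm (a j))" and z: "norm z \<le> 1" and v: "(\<lambda>j. a j * z ^ j) sums v"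
  shows "norm (v - (\<Sum>j\<le>N. a j * z ^ j)) \<le> (\<Sum>j. norm (a j)) * norm z ^ Suc N"
proof -
  have "(\<lambda>j. a (j + Suc N) * z ^ (j + Suc N)) sums (v - (\<Sum>j\<le>N. a j * z ^ j))"
    using sums_split_initial_segment[OF v, of "Suc N"] by (simp only: lessThan_Suc_atMost)
  then have eq: "v - (\<Sum>j\<le>N. a j * z ^ j) = (\<Sum>j. a (j + Suc N) * z ^ (j + Suc N))"
    by (rule sums_unique)
  have le: "norm (a (j + Suc N) * z ^ (j + Suc N)) \<le> norm (a (j + Suc N)) * norm z ^ Suc N" for j
  proof -
    have "norm z ^ (j + Suc N) \<le> norm z ^ Suc N" using z by (intro power_decreasing) auto
    then show ?thesis by (simp only: norm_mult norm_power) (intro mult_left_mono, auto)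
  qed
  have sm: "summable (\<lambda>j. norm (a (j + Suc N)))" using a by (rule summable_ignore_initial_segment)
  have sm2: "summable (\<lambda>j. norm (a (j + Suc N) * z ^ (j + Suc N)))"
    by (rule summable_comparison_test'[OF summable_mult2[OF sm, of "norm z ^ Suc N"], of 0])
      (use le in simp)
  have "norm (v - (\<Sum>j\<le>N. a j * z ^ j)) \<le> (\<Sum>j. norm (a (j + Suc N) * z ^ (j + Suc N)))"
    unfolding eq by (rule summable_norm[OF sm2])
  also have "\<dots> \<le> (\<Sum>j. norm (a (j + Suc N)) * norm z ^ Suc N)"
    by (intro suminf_le le sm2 summable_mult2 sm)
  also have "\<dots> = (\<Sum>j. norm (a (j + Suc N))) * norm z ^ Suc N"
    using sm by (rule suminf_mult2[symmetric])
  also have "\<dots> \<le> (\<Sum>j. norm (a j)) * norm z ^ Suc N"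
    using suminf_split_initial_segment[OF a, of "Suc N"]
    by (intro mult_right_mono) (auto simp: sum_nonneg)
  finally show ?thesis .
qed

text \<open>Binomial expansion of \<open>(1 - iexp y) ^ (2 * n)\<close>, recentred by
  \<open>iexp (- n * y)\<close>. Even order with symmetric nodes is what makes the result real and
  of constant sign.\<close>

lemma cos_power_eq_alternating_sum:
  fixes y :: real
  shows "complex_of_real ((2 * cos y - 2) ^ n) =
    (\<Sum>k\<le>2*n. (-1) ^ k * of_nat (2*n choose k) * iexp ((real k - real n) * y))"
proof -
  have "(\<Sum>k\<le>2*n. (-1) ^ k * of_nat (2*n choose k) * iexp ((real k - real n) * y)) =
      (\<Sum>k\<le>2*n. of_nat (2*n choose k) * (- iexp y) ^ k) * (iexp (- y)) ^ n"
    unfolding sum_distrib_right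
    by (intro sum.cong refl)
      (simp add: power_minus[of "iexp y"] algebra_simps flip: exp_add exp_of_nat_mult)
  also have "(\<Sum>k\<le>2*n. of_nat (2*n choose k) * (- iexp y) ^ k) = (1 - iexp y) ^ (2 * n)"
    using binomial_ring[of "- iexp y" 1 "2 * n"] by simp
  also have "\<dots> * (iexp (- y)) ^ n = ((1 - iexp y)\<^sup>2 * iexp (- y)) ^ n"
    by (simp add: power_mult power_mult_distrib)
  also have "(1 - iexp y)\<^sup>2 * iexp (- y) = complex_of_real (2 * cos y - 2)"
  proof -
    have "iexp y * iexp (- y) = 1" by (simp flip: exp_add)
    then have "(1 - iexp y)\<^sup>2 * iexp (- y) = iexp (- y) - 2 + iexp y"
      by (simp add: power2_eq_square algebra_simps)
    also have "\<dots> = complex_of_real (2 * cos y - 2)"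
      by (simp add: complex_eq_iff Re_exp Im_exp)
    finally show ?thesis .
  qed
  finally show ?thesis by simp
qed

text \<open>The \<open>2n\<close>-th central difference of the characteristic function is the expectation of a
  nonnegative function, so Fatou's lemma applies.\<close>

lemma even_moment_le:
  fixes a :: "nat \<Rightarrow> complex"
  assumes "real_distribution \<mu>" and a: "summable (\<lambda>j. norm (a j))"
    and ch: "\<And>t. \<bar>t\<bar> \<le> 1 \<Longrightarrow> (\<lambda>j. a j * (\<i> * of_real t) ^ j) sums char \<mu> t"
  shows "(\<integral>\<^sup>+x. ennreal (x ^ (2 * n)) \<partial>\<mu>) \<le> ennreal (fact (2 * n) * norm (a (2 * n)))"
proof -
  interpret real_distribution \<mu> by fact
  \<comment> \<open>Up to sign, this is the central difference quotient of order
    \<open>2 * n\<close> and step \<open>1 / m\<close> of \<open>iexp (t * x)\<close> at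
    \<open>t = 0\<close>. It is nonnegative, bounded for fixed \<open>m\<close>, and tends to
    \<open>x ^ (2 * n)\<close>.\<close>
  define D where "D m x = ((real m)\<^sup>2 * (2 - 2 * cos (x / real m))) ^ n" for m :: nat and x :: real
  define A where "A = (\<Sum>j. norm (a j))"
  define R where "R m = fact (2 * n) * norm (a (2 * n)) + 2 ^ (2 * n) * A * real n ^ (2 * n + 1) / real m"
    for m :: nat
  have D0: "D m x \<ge> 0" for m x by (simp add: D_def)
  have meas[measurable]: "D m \<in> borel_measurable \<mu>" for m
    unfolding D_def by measurable
  have int: "integrable \<mu> (D m)" for m
  proof (rule integrable_const_bound[of _ "((real m)\<^sup>2 * 4) ^ n"])
    have "2 - 2 * cos (x / real m) \<le> 4" for x using cos_ge_minus_one[of "x / real m"] by linarith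
    then have "D m x \<le> ((real m)\<^sup>2 * 4) ^ n" for x
      unfolding D_def by (intro power_mono mult_left_mono mult_nonneg_nonneg) auto
    then show "AE x in \<mu>. norm (D m x) \<le> ((real m)\<^sup>2 * 4) ^ n"
      using D0 by simp
  qed measurable
  have D_lim: "(\<lambda>m. D m x) \<longlonglongrightarrow> x ^ (2 * n)" for x
  proof -
    have "(\<lambda>m::nat. (real m)\<^sup>2 * (2 - 2 * cos (x / real m))) \<longlonglongrightarrow> x * x" by real_asymp
    then have "(\<lambda>m::nat. (real m)\<^sup>2 * (2 - 2 * cos (x / real m))) \<longlonglongrightarrow> x\<^sup>2"
      by (simp only: power2_eq_square)
    then show ?thesis unfolding D_def power_mult by (rule tendsto_power)
  qed
  \<comment> \<open>The condition \<open>m \<ge> n\<close> keeps all nodes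
    \<open>(k - n) / m\<close> in the interval where the expansion is assumed. After division by the
    step to the power \<open>2 * n\<close>, the Taylor remainder is of order
    \<open>1 / m\<close>.\<close>
  have bound: "(\<integral>x. D m x \<partial>\<mu>) \<le> R m" if m: "m \<ge> 1" "m \<ge> n" for m
  proof -
    define h where "h = \<i> / of_nat m"
    define f where "f k = char \<mu> ((real k - real n) / real m)" for k
    have "complex_of_real (\<integral>x. D m x \<partial>\<mu>) = (CLINT x|\<mu>. complex_of_real (D m x))" by simp
    also have "\<dots> = (CLINT x|\<mu>. (-1) ^ n * of_nat m ^ (2 * n) *
        (\<Sum>k\<le>2*n. (-1) ^ k * of_nat (2*n choose k) * iexp ((real k - real n) / real m * x)))"
    proof (rule Bochner_Integration.integral_cong[OF refl])
      fix x
      have "complex_of_real (D m x) = (-1) ^ n * of_nat m ^ (2 * n) *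
          complex_of_real ((2 * cos (x / real m) - 2) ^ n)"
      proof -
        have "D m x = ((-1) * ((real m)\<^sup>2 * (2 * cos (x / real m) - 2))) ^ n"
          unfolding D_def by (simp add: algebra_simps)
        also have "\<dots> = (-1) ^ n * (real m ^ (2 * n) * (2 * cos (x / real m) - 2) ^ n)"
          by (simp only: power_mult_distrib power_mult)
        finally show ?thesis by simp
      qed
      then show "complex_of_real (D m x) = (-1) ^ n * of_nat m ^ (2 * n) *
          (\<Sum>k\<le>2*n. (-1) ^ k * of_nat (2*n choose k) * iexp ((real k - real n) / real m * x))"
        unfolding cos_power_eq_alternating_sum by simp
    qed
    also have "\<dots> = (-1) ^ n * of_nat m ^ (2 * n) *
        (\<Sum>k\<le>2*n. (-1) ^ k * of_nat (2*n choose k) * f k)"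
    proof -
      have "integrable \<mu> (\<lambda>x. iexp (t * x))" for t
        by (intro integrable_const_bound[of _ 1]) auto
      then show ?thesis
        unfolding f_def char_def
        by (simp only: integral_mult_right_zero Bochner_Integration.integral_sum integrable_mult_right)
    qed
    finally have "(\<integral>x. D m x \<partial>\<mu>) = norm ((-1) ^ n * of_nat m ^ (2 * n) *
        (\<Sum>k\<le>2*n. (-1) ^ k * of_nat (2*n choose k) * f k))"
      using D0 by (metis Bochner_Integration.integral_nonneg norm_of_real abs_of_nonneg)
    also have "\<dots> = real m ^ (2 * n) * norm (\<Sum>k\<le>2*n. (-1) ^ k * of_nat (2*n choose k) * f k)"
      by (simp add: norm_mult norm_power)
    also have "norm (\<Sum>k\<le>2*n. (-1) ^ k * of_nat (2*n choose k) * f k) \<le>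
        norm ((-1) ^ (2 * n) * fact (2 * n) * a (2 * n) * h ^ (2 * n)) +
        2 ^ (2 * n) * (A * (real n / real m) ^ Suc (2 * n))"
    proof -
      have "norm ((\<Sum>k\<le>2*n. (-1) ^ k * of_nat (2*n choose k) * f k) -
          (-1) ^ (2 * n) * fact (2 * n) * a (2 * n) * h ^ (2 * n)) \<le>
          2 ^ (2 * n) * (A * (real n / real m) ^ Suc (2 * n))"
      proof (rule finite_difference_coefficient[where c = "- of_nat n"])
        fix k assume k: "k \<le> 2 * n"
        define t where "t = (real k - real n) / real m"
        have eq: "(- of_nat n + of_nat k) * h = \<i> * of_real t" by (simp add: h_def t_def)
        have t: "\<bar>t\<bar> \<le> real n / real m" using k by (simp add: t_def divide_right_mono)
        also have "real n / real m \<le> 1" using m by simp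
        finally have t1: "\<bar>t\<bar> \<le> 1" .
        have "norm (f k - (\<Sum>j\<le>2 * n. a j * (\<i> * of_real t) ^ j)) \<le> A * norm (\<i> * complex_of_real t) ^ Suc (2 * n)"
          unfolding f_def t_def[symmetric] A_def using t1 by (intro power_series_remainder_le a ch) (auto simp: norm_mult)
        also have "\<dots> \<le> A * (real n / real m) ^ Suc (2 * n)"
          using t by (intro mult_left_mono power_mono) (auto simp: A_def norm_mult intro!: suminf_nonneg a)
        finally show "norm (f k - (\<Sum>j\<le>2 * n. a j * ((- of_nat n + of_nat k) * h) ^ j)) \<le>
            A * (real n / real m) ^ Suc (2 * n)" unfolding eq .
      qed
      then show ?thesis by (rule norm_le_of_norm_diff_le)
    qed
    also have "real m ^ (2 * n) * (norm ((-1) ^ (2 * n) * fact (2 * n) * a (2 * n) * h ^ (2 * n)) +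
        2 ^ (2 * n) * (A * (real n / real m) ^ Suc (2 * n))) = R m"
      using m by (simp add: R_def norm_mult norm_power norm_divide h_def field_simps)
    finally show ?thesis using m by (simp add: mult_left_mono)
  qed
  have "(\<integral>\<^sup>+x. ennreal (x ^ (2 * n)) \<partial>\<mu>) = (\<integral>\<^sup>+x. liminf (\<lambda>m. ennreal (D m x)) \<partial>\<mu>)"
    by (intro nn_integral_cong, subst lim_imp_Liminf[OF _ tendsto_ennrealI[OF D_lim]]) auto
  also have "\<dots> \<le> liminf (\<lambda>m. \<integral>\<^sup>+x. ennreal (D m x) \<partial>\<mu>)"
    by (intro nn_integral_liminf) measurable
  also have "\<dots> \<le> liminf (\<lambda>m. ennreal (R m))"
  proof (rule Liminf_mono)
    show "\<forall>\<^sub>F m in sequentially. (\<integral>\<^sup>+x. ennreal (D m x) \<partial>\<mu>) \<le> ennreal (R m)"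
      using eventually_ge_at_top[of 1] eventually_ge_at_top[of n]
      by eventually_elim (simp add: nn_integral_eq_integral int D0 bound ennreal_leI)
  qed
  also have "\<dots> = ennreal (fact (2 * n) * norm (a (2 * n)))"
  proof (rule lim_imp_Liminf)
    have "R \<longlonglongrightarrow> fact (2 * n) * norm (a (2 * n)) + 0"
      unfolding R_def by (intro tendsto_add tendsto_const lim_const_over_n)
    then show "(\<lambda>m. ennreal (R m)) \<longlonglongrightarrow> ennreal (fact (2 * n) * norm (a (2 * n)))"
      by (intro tendsto_ennrealI) simp
  qed simp
  finally show ?thesis .
qed

lemma exp_abs_le_cosh: "exp \<bar>y\<bar> \<le> 2 * cosh (y::real)"
  by (cases "y \<ge> 0") (auto simp: cosh_def)

text \<open>The Taylor coefficients bound all even moments, and the series of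
  \<open>cosh (r * x)\<close> contains only those, so it is integrable for every \<open>r\<close>.
  The moment generating function is therefore entire; it agrees with \<open>G\<close> on the
  imaginary axis, hence everywhere.\<close>

proposition exp_moment_of_entire_char:
  fixes a :: "nat \<Rightarrow> complex"
  assumes "real_distribution \<mu>" and G: "\<And>z. (\<lambda>j. a j * z ^ j) sums G z"
    and ch: "\<And>t. char \<mu> t = G (\<i> * of_real t)"
  shows "integrable \<mu> (\<lambda>x. exp (s * x))"
    and "complex_of_real (\<integral>x. exp (s * x) \<partial>\<mu>) = G (of_real s)"
proof -
  interpret real_distribution \<mu> by fact
  have abs_sm: "summable (\<lambda>j. norm (a j * of_real r ^ j))" for r :: real
  proof (rule powser_insidea)
    show "summable (\<lambda>j. a j * complex_of_real (\<bar>r\<bar> + 1) ^ j)" using G by (rule sums_summable)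
  qed simp
  have mom: "(\<integral>\<^sup>+x. ennreal (x ^ (2 * n)) \<partial>\<mu>) \<le> ennreal (fact (2 * n) * norm (a (2 * n)))" for n
    using abs_sm[of 1] ch G by (intro even_moment_le) (auto simp: \<open>real_distribution \<mu>\<close>)
  have cosh_int: "integrable \<mu> (\<lambda>x. cosh (r * x))" for r :: real
  proof (rule integrableI_bounded)
    define e where "e j x = (if even j then (r * x) ^ j / fact j else 0)" for j :: nat and x :: real
    have e0: "e j x \<ge> 0" for j x by (auto simp: e_def)
    have "(\<integral>\<^sup>+x. norm (cosh (r * x)) \<partial>\<mu>) = (\<integral>\<^sup>+x. (\<Sum>j. ennreal (e j x)) \<partial>\<mu>)"
    proof (rule nn_integral_cong)
      fix x
      have "(\<lambda>j. e j x) sums cosh (r * x)"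
        using cosh_converges[of "r * x"] by (simp add: e_def divide_inverse mult.commute cong: if_cong)
      then show "ennreal (norm (cosh (r * x))) = (\<Sum>j. ennreal (e j x))"
        using e0 by (simp add: suminf_ennreal2 sums_iff)
    qed
    also have "\<dots> = (\<Sum>j. \<integral>\<^sup>+x. ennreal (e j x) \<partial>\<mu>)"
      unfolding e_def by (intro nn_integral_suminf) measurable
    also have "\<dots> \<le> (\<Sum>j. ennreal (norm (a j * of_real r ^ j)))"
    proof (intro suminf_le summableI)
      fix j
      show "(\<integral>\<^sup>+x. ennreal (e j x) \<partial>\<mu>) \<le> ennreal (norm (a j * of_real r ^ j))"
      proof (cases "even j")
        case True
        then obtain n where j: "j = 2 * n" by (auto elim: evenE)
        have "(\<integral>\<^sup>+x. ennreal (e j x) \<partial>\<mu>) =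
            (\<integral>\<^sup>+x. ennreal (r ^ (2 * n) / fact (2 * n)) * ennreal (x ^ (2 * n)) \<partial>\<mu>)"
          by (intro nn_integral_cong) (simp add: e_def j power_mult_distrib flip: ennreal_mult)
        also have "\<dots> = ennreal (r ^ (2 * n) / fact (2 * n)) * (\<integral>\<^sup>+x. ennreal (x ^ (2 * n)) \<partial>\<mu>)"
          by (intro nn_integral_cmult) measurable
        also have "\<dots> \<le> ennreal (r ^ (2 * n) / fact (2 * n)) * ennreal (fact (2 * n) * norm (a (2 * n)))"
          by (intro mult_left_mono mom) simp
        also have "\<dots> = ennreal (norm (a j * of_real r ^ j))"
          by (subst ennreal_mult[symmetric])
            (simp_all add: j norm_mult norm_power mult.commute power_even_abs zero_le_even_power)
        finally show ?thesis .
      qed (simp add: e_def)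
    qed
    also have "\<dots> = ennreal (\<Sum>j. norm (a j * of_real r ^ j))"
      by (intro suminf_ennreal2 abs_sm) simp
    also have "\<dots> < \<infinity>" by simp
    finally show "(\<integral>\<^sup>+x. norm (cosh (r * x)) \<partial>\<mu>) < \<infinity>" .
  qed (simp add: cosh_def)
  show int: "integrable \<mu> (\<lambda>x. exp (s * x))"
  proof (rule Bochner_Integration.integrable_bound)
    show "integrable \<mu> (\<lambda>x. 2 * cosh (s * x))" using cosh_int by simp
    show "AE x in \<mu>. norm (exp (s * x)) \<le> norm (2 * cosh (s * x))"
    proof (intro AE_I2)
      fix x
      have "exp (s * x) \<le> exp \<bar>s * x\<bar>" by simp
      also note exp_abs_le_cosh
      finally show "norm (exp (s * x)) \<le> norm (2 * cosh (s * x))" by simp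
    qed
  qed simp
  define b where "b j = complex_of_real (\<integral>x. x ^ j / fact j \<partial>\<mu>)" for j
  define M where "M z = (CLINT x|\<mu>. exp (z * complex_of_real x))" for z
  have M: "(\<lambda>j. b j * z ^ j) sums M z" for z
  proof -
    define S where "S n x = (\<Sum>j<n. (z * complex_of_real x) ^ j / fact j)" for n :: nat and x :: real
    \<comment> \<open>An arbitrary finite \<open>J\<close> covers both uses: initial segments for
      dominated convergence, singletons for the integrability of each term.\<close>
    have bd: "(\<Sum>j\<in>J. norm ((z * complex_of_real x) ^ j / fact j)) \<le> 2 * cosh (norm z * x)"
      if "finite J" for J x
    proof -
      have "(\<Sum>j\<in>J. norm ((z * complex_of_real x) ^ j / fact j)) =
          (\<Sum>j\<in>J. \<bar>norm z * x\<bar> ^ j /\<^sub>R fact j)"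
        by (simp add: norm_inverse norm_power norm_mult abs_mult divide_inverse mult.commute)
      also have "\<dots> \<le> exp \<bar>norm z * x\<bar>"
        unfolding exp_def using that
        by (intro sum_le_suminf summable_exp_generic) auto
      also note exp_abs_le_cosh
      finally show ?thesis .
    qed
    have cint: "integrable \<mu> (\<lambda>x. 2 * cosh (norm z * x))" using cosh_int by simp
    have "(\<lambda>n. CLINT x|\<mu>. S n x) \<longlonglongrightarrow> M z"
      unfolding M_def
    proof (rule integral_dominated_convergence[OF _ _ cint])
      show "AE x in \<mu>. (\<lambda>n. S n x) \<longlonglongrightarrow> exp (z * complex_of_real x)"
        using exp_converges[of "z * complex_of_real _"]
        by (intro AE_I2) (simp add: S_def sums_def scaleR_conv_of_real divide_inverse mult.commute)
      show "AE x in \<mu>. norm (S n x) \<le> 2 * cosh (norm z * x)" for n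
        unfolding S_def by (intro AE_I2 order_trans[OF norm_sum bd]) simp
    qed (simp_all add: S_def)
    moreover have "(CLINT x|\<mu>. S n x) = (\<Sum>j<n. b j * z ^ j)" for n
    proof -
      have pint: "integrable \<mu> (\<lambda>x. (z * complex_of_real x) ^ j / fact j)" for j
      proof (rule Bochner_Integration.integrable_bound[OF cint])
        show "AE x in \<mu>. norm ((z * complex_of_real x) ^ j / fact j) \<le> norm (2 * cosh (norm z * x))"
          using bd[of "{j}"] by (intro AE_I2) simp
      qed simp
      have "(CLINT x|\<mu>. S n x) = (\<Sum>j<n. CLINT x|\<mu>. (z * complex_of_real x) ^ j / fact j)"
        unfolding S_def by (intro Bochner_Integration.integral_sum pint)
      also have "\<dots> = (\<Sum>j<n. b j * z ^ j)"
      proof (rule sum.cong[OF refl])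
        fix j
        have "(CLINT x|\<mu>. (z * complex_of_real x) ^ j / fact j) =
            (CLINT x|\<mu>. z ^ j * complex_of_real (x ^ j / fact j))"
          by (simp add: power_mult_distrib)
        also have "\<dots> = z ^ j * b j" unfolding b_def by (subst integral_mult_right_zero) (simp only: integral_complex_of_real)
        finally show "(CLINT x|\<mu>. (z * complex_of_real x) ^ j / fact j) = b j * z ^ j" by simp
      qed
      finally show ?thesis .
    qed
    ultimately show ?thesis by (simp add: sums_def)
  qed
  \<comment> \<open>Identity theorem on a disc containing \<open>s\<close>. Its radius is at least
    1, so it contains the segment of the imaginary axis on which the two functions are known to
    agree; that segment accumulates at 0.\<close>
  have "M (of_real s) - G (of_real s) = 0"
  proof (rule analytic_continuation[where f = "\<lambda>z. M z - G z" and S = "ball 0 (\<bar>s\<bar> + 1)"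
        and U = "(\<lambda>t. \<i> * complex_of_real t) ` {-1/2..1/2}" and \<xi> = 0])
    have "M holomorphic_on ball 0 (\<bar>s\<bar> + 1)" using M by (intro power_series_holomorphic) simp
    moreover have "G holomorphic_on ball 0 (\<bar>s\<bar> + 1)" using G by (intro power_series_holomorphic) simp
    ultimately show "(\<lambda>z. M z - G z) holomorphic_on ball 0 (\<bar>s\<bar> + 1)"
      by (rule holomorphic_on_diff)
    show "0 islimpt (\<lambda>t. \<i> * complex_of_real t) ` {-1/2..1/2}"
      unfolding islimpt_sequential
    proof (intro exI conjI allI)
      define w where "w n = \<i> * complex_of_real (1 / real (n + 2))" for n :: nat
      show "w n \<in> (\<lambda>t. \<i> * complex_of_real t) ` {-1/2..1/2} - {0}" for n
      proof -
        have "1 / real (n + 2) \<in> {-1/2..1/2}" by (auto simp: field_simps)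
        then have "w n \<in> (\<lambda>t. \<i> * complex_of_real t) ` {-1/2..1/2}"
          unfolding w_def by (rule imageI)
        moreover have "w n \<noteq> 0" unfolding w_def mult_eq_0_iff of_real_eq_0_iff by simp
        ultimately show ?thesis by simp
      qed
      have "(\<lambda>n. 1 / real (n + 2)) \<longlonglongrightarrow> 0" by real_asymp
      then have "w \<longlonglongrightarrow> \<i> * complex_of_real 0"
        unfolding w_def by (intro tendsto_intros)
      then show "w \<longlonglongrightarrow> 0" by simp
    qed
    fix z assume "z \<in> (\<lambda>t. \<i> * complex_of_real t) ` {-1/2..1/2}"
    then obtain t where "z = \<i> * complex_of_real t" by auto
    then show "M z - G z = 0"
      unfolding M_def by (simp add: ch[symmetric] char_def mult_ac)
  qed (auto simp: norm_mult)
  moreover have "M (of_real s) = complex_of_real (\<integral>x. exp (s * x) \<partial>\<mu>)"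
    unfolding M_def by (simp add: exp_of_real flip: of_real_mult)
  ultimately show "complex_of_real (\<integral>x. exp (s * x) \<partial>\<mu>) = G (of_real s)" by simp
qed

section \<open>Exponential moments from tails\<close>

lemma exp_1_ge_2: "exp (1::real) \<ge> 2"
  using exp_ge_add_one_self[of 1] by simp

text \<open>The last grid point not exceeding \<open>X\<close> is within \<open>1 / s\<close> of
  \<open>X\<close>, so its term alone gives \<open>exp (s * X)\<close> up to a factor
  \<open>exp 1\<close>.\<close>

lemma exp_le_sum_grid:
  fixes s b X :: real
  assumes "s > 0" "b \<le> X" "X < b + real J / s"
  shows "exp (s * X) \<le> exp 1 * (\<Sum>j<J. exp (s * b) * exp (real j) * of_bool (b + real j / s \<le> X))"
  using assms(3)
proof (induction J)
  case (Suc J)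
  show ?case
  proof (cases "X < b + real J / s")
    case True
    have "(\<Sum>j<J. exp (s * b) * exp (real j) * of_bool (b + real j / s \<le> X)) \<le>
        (\<Sum>j<Suc J. exp (s * b) * exp (real j) * of_bool (b + real j / s \<le> X))"
      by simp
    then show ?thesis
      using Suc.IH[OF True] by (meson exp_ge_zero mult_left_mono order_trans)
  next
    case False
    have "s * X \<le> s * b + real J + 1" using Suc.prems assms(1) by (simp add: field_simps)
    then have "exp (s * X) \<le> exp 1 * (exp (s * b) * exp (real J))"
      by (simp flip: exp_add)
    also have "\<dots> \<le> exp 1 * (\<Sum>j<Suc J. exp (s * b) * exp (real j) * of_bool (b + real j / s \<le> X))"
      using False by (intro mult_left_mono) (auto simp: sum_nonneg)
    finally show ?thesis .
  qed
qed (use assms in auto)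

text \<open>The nonzero terms form a geometric progression of ratio \<open>exp 1 \<ge> 2\<close>, so
  they sum to at most twice the last one, which is at most \<open>exp (s * X)\<close>.\<close>

lemma sum_grid_le_exp:
  fixes s b X :: real
  assumes "s > 0"
  shows "(\<Sum>j<J. exp (s * b) * exp (real j) * of_bool (b + real j / s \<le> X)) \<le> 2 * exp (s * X)"
    (is "?S J \<le> _")
proof -
  \<comment> \<open>The second bound strengthens the induction: all earlier terms together do not
    exceed the next one.\<close>
  have "?S J \<le> 2 * exp (s * X) \<and> ?S J \<le> exp (s * b) * exp (real J)"
  proof (induction J)
    case (Suc J)
    have "2 * exp (real J) \<le> exp (real (Suc J))"
      using exp_1_ge_2 by (simp add: exp_add)
    then have *: "2 * (exp (s * b) * exp (real J)) \<le> exp (s * b) * exp (real (Suc J))" by simp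
    show ?case
    proof (cases "b + real J / s \<le> X")
      case True
      then have "s * b + real J \<le> s * X" using assms by (simp add: field_simps)
      then have "exp (s * b) * exp (real J) \<le> exp (s * X)" by (simp flip: exp_add)
      moreover have "?S (Suc J) = ?S J + exp (s * b) * exp (real J)"
        using True by (simp del: sum_mult_of_bool_eq)
      ultimately show ?thesis using Suc * by linarith
    next
      case False
      then have "?S (Suc J) = ?S J" by (simp del: sum_mult_of_bool_eq)
      moreover have "0 \<le> exp (s * b) * exp (real J)" by simp
      ultimately show ?thesis using Suc * by linarith
    qed
  qed auto
  then show ?thesis by simp
qed

text \<open>Tail comparison on the window from \<open>b\<close> to \<open>y\<close> transfers exponential moments: summing
  tails over a grid of mesh \<open>1 / s\<close> recovers \<open>exp (s * X)\<close> up to a constant.\<close>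

lemma exp_moment_le_of_tail_le:
  fixes X :: "'a \<Rightarrow> real" and Y :: "'b \<Rightarrow> real"
  assumes "finite_measure N1" "finite_measure N2" and mass: "measure N1 (space N1) \<le> 1"
    and X[measurable]: "X \<in> borel_measurable N1" and Y[measurable]: "Y \<in> borel_measurable N2"
    and s: "s > 0"
    and iX: "integrable N1 (\<lambda>w. exp (s * X w))" "integrable N1 (\<lambda>w. exp (2 * s * X w))"
    and iY: "integrable N2 (\<lambda>w. exp (s * Y w))"
    and tails: "\<And>v. b \<le> v \<Longrightarrow> v \<le> y \<Longrightarrow>
      measure N1 {w \<in> space N1. v \<le> X w} \<le> 2 * measure N2 {w \<in> space N2. v \<le> Y w}"
  shows "(\<integral>w. exp (s * X w) \<partial>N1) \<le>
    exp (s * b) + 4 * exp 1 * (\<integral>w. exp (s * Y w) \<partial>N2) + exp (- s * y) * (\<integral>w. exp (2 * s * X w) \<partial>N1)"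
proof -
  interpret N1: finite_measure N1 by fact
  interpret N2: finite_measure N2 by fact
  \<comment> \<open>The least number of steps that reaches \<open>y\<close>: the grid points with
    index below \<open>J\<close> stay in the window, while \<open>v J\<close> is already at least
    \<open>y\<close>.\<close>
  define J where "J = nat \<lceil>s * (y - b)\<rceil>"
  define c where "c j = exp (s * b) * exp (real j)" for j :: nat
  define v where "v j = b + real j / s" for j :: nat
  have vJ: "y \<le> v J"
  proof -
    have "s * (y - b) \<le> real J" unfolding J_def by linarith
    then show ?thesis using s by (simp add: v_def field_simps)
  qed
  have vj: "b \<le> v j" "v j \<le> y" if "j < J" for j
  proof -
    have "real j \<le> s * (y - b)" using that unfolding J_def by linarith
    then show "v j \<le> y" using s by (simp add: v_def field_simps)
    show "b \<le> v j" using s by (simp add: v_def)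
  qed
  have c0: "c j \<ge> 0" for j by (simp add: c_def)
  define f1 where "f1 j w = c j * of_bool (v j \<le> X w)" for j w
  define f2 where "f2 j w = c j * of_bool (v j \<le> Y w)" for j w
  have int1: "integrable N1 (\<lambda>w. f1 j w)" for j
    unfolding f1_def by (rule N1.integrable_const_bound[of _ "c j"]) (auto simp: c0)
  have int2: "integrable N2 (\<lambda>w. f2 j w)" for j
    unfolding f2_def by (rule N2.integrable_const_bound[of _ "c j"]) (auto simp: c0)
  have m1: "(\<integral>w. f1 j w \<partial>N1) = c j * measure N1 {w \<in> space N1. v j \<le> X w}" for j
  proof -
    have "(\<integral>w. of_bool (v j \<le> X w) \<partial>N1) = (\<integral>w. indicat_real {w \<in> space N1. v j \<le> X w} w \<partial>N1)"
      by (intro Bochner_Integration.integral_cong) (auto simp: indicator_def)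
    then show ?thesis unfolding f1_def by (simp add: Int_def cong: conj_cong)
  qed
  have m2: "(\<integral>w. f2 j w \<partial>N2) = c j * measure N2 {w \<in> space N2. v j \<le> Y w}" for j
  proof -
    have "(\<integral>w. of_bool (v j \<le> Y w) \<partial>N2) = (\<integral>w. indicat_real {w \<in> space N2. v j \<le> Y w} w \<partial>N2)"
      by (intro Bochner_Integration.integral_cong) (auto simp: indicator_def)
    then show ?thesis unfolding f2_def by (simp add: Int_def cong: conj_cong)
  qed
  \<comment> \<open>Below \<open>b\<close> the first term suffices, inside the window the grid, and
    above \<open>y\<close> one has \<open>s * X w \<le> 2 * s * X w - s * y\<close>. The constant 4
    in the claim is 2 from the tail hypothesis times 2 from \<open>sum_grid_le_exp\<close>.\<close>
  have pw: "exp (s * X w) \<le> exp (s * b) + exp 1 * (\<Sum>j<J. f1 j w) +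
      exp (- s * y) * exp (2 * s * X w)" for w
  proof -
    have S: "0 \<le> exp 1 * (\<Sum>j<J. f1 j w)" by (simp add: f1_def c0 sum_nonneg)
    consider "X w \<le> b" | "b \<le> X w" "X w < v J" | "v J \<le> X w" by linarith
    then show ?thesis
    proof cases
      case 1
      then have "exp (s * X w) \<le> exp (s * b)" using s by simp
      moreover have "0 \<le> exp (- s * y) * exp (2 * s * X w)" by simp
      ultimately show ?thesis using S by linarith
    next
      case 2
      then have "exp (s * X w) \<le> exp 1 * (\<Sum>j<J. f1 j w)"
        unfolding f1_def c_def v_def by (intro exp_le_sum_grid s) auto
      moreover have "0 \<le> exp (- s * y) * exp (2 * s * X w)" "0 \<le> exp (s * b)" by simp_all
      ultimately show ?thesis by linarith
    next
      case 3
      then have "s * y \<le> s * X w" using vJ s by simp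
      then have "s * X w \<le> - s * y + 2 * s * X w" by simp
      then have "exp (s * X w) \<le> exp (- s * y) * exp (2 * s * X w)"
        by (simp only: flip: exp_add) simp
      moreover have "0 \<le> exp (s * b)" by simp
      ultimately show ?thesis using S by linarith
    qed
  qed
  have "(\<integral>w. exp (s * X w) \<partial>N1) \<le> (\<integral>w. exp (s * b) + exp 1 * (\<Sum>j<J. f1 j w) +
      exp (- s * y) * exp (2 * s * X w) \<partial>N1)"
    by (intro integral_mono iX Bochner_Integration.integrable_add integrable_mult_right
        Bochner_Integration.integrable_sum int1 pw) simp
  also have "\<dots> = exp (s * b) * measure N1 (space N1) +
      exp 1 * (\<Sum>j<J. c j * measure N1 {w \<in> space N1. v j \<le> X w}) +
      exp (- s * y) * (\<integral>w. exp (2 * s * X w) \<partial>N1)"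
    using int1 iX(2) m1 by simp
  also have "\<dots> \<le> exp (s * b) + exp 1 * (4 * (\<integral>w. exp (s * Y w) \<partial>N2)) +
      exp (- s * y) * (\<integral>w. exp (2 * s * X w) \<partial>N1)"
  proof -
    have "(\<Sum>j<J. c j * measure N1 {w \<in> space N1. v j \<le> X w}) \<le>
        (\<Sum>j<J. c j * (2 * measure N2 {w \<in> space N2. v j \<le> Y w}))"
      using vj c0 by (intro sum_mono mult_left_mono tails) auto
    also have "\<dots> = 2 * (\<integral>w. (\<Sum>j<J. f2 j w) \<partial>N2)"
      using int2 m2 by (simp add: sum_distrib_left mult.left_commute)
    also have "\<dots> \<le> 2 * (\<integral>w. 2 * exp (s * Y w) \<partial>N2)"
      unfolding f2_def c_def v_def
      using int2[unfolded f2_def c_def v_def] iY sum_grid_le_exp[OF s]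
      by (intro mult_left_mono integral_mono Bochner_Integration.integrable_sum)
        (auto simp del: sum_mult_of_bool_eq)
    finally have "(\<Sum>j<J. c j * measure N1 {w \<in> space N1. v j \<le> X w}) \<le> 4 * (\<integral>w. exp (s * Y w) \<partial>N2)"
      by simp
    moreover have "exp (s * b) * measure N1 (space N1) \<le> exp (s * b)"
      using mass by simp
    ultimately show ?thesis by (intro add_mono mult_left_mono) auto
  qed
  finally show ?thesis by simp
qed

section \<open>Cumulants and moments\<close>

lemma exp_remainder_sums:
  fixes y :: "'a::{real_normed_field,banach}"
  shows "(\<lambda>k. y ^ (k + 2) / fact (k + 2)) sums (exp y - 1 - y)"
proof -
  have "(\<lambda>k. y ^ k / fact k) sums exp y"
    using exp_converges[of y] by (simp add: scaleR_conv_of_real divide_inverse mult.commute)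
  from sums_split_initial_segment[OF this, of 2] show ?thesis
    by (simp add: numeral_2_eq_2 diff_diff_eq)
qed

text \<open>\<open>cumul m\<close> is the cumulant generating function of the centred infinitely divisible law
  whose Kolmogorov canonical measure has moments \<open>m\<close>.\<close>

definition cumul :: "(nat \<Rightarrow> real) \<Rightarrow> real \<Rightarrow> real" where
  "cumul m s = (\<Sum>k. m k * s ^ (k + 2) / fact (k + 2))"

lemma fact_add_2_ge: "2 * fact k \<le> (fact (k + 2) :: real)"
proof -
  have "(2::real) * 1 \<le> (real k + 2) * (real k + 1)" by (intro mult_mono) auto
  then have "2 * fact k \<le> (real k + 2) * (real k + 1) * fact k"
    by (intro mult_right_mono) auto
  also have "\<dots> = fact (k + 2)" by (simp add: numeral_2_eq_2 algebra_simps)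
  finally show ?thesis .
qed

lemma cumul_term_le:
  fixes s :: real
  assumes "\<bar>m\<bar> \<le> A ^ k" "A \<ge> 0"
  shows "\<bar>m * s ^ (k + 2) / fact (k + 2)\<bar> \<le> s\<^sup>2 / 2 * ((A * \<bar>s\<bar>) ^ k / fact k)"
proof -
  have "\<bar>m * s ^ (k + 2) / fact (k + 2)\<bar> = \<bar>m\<bar> * \<bar>s\<bar> ^ (k + 2) / fact (k + 2)"
    by (simp add: abs_mult power_abs del: fact_Suc)
  also have "\<dots> \<le> A ^ k * \<bar>s\<bar> ^ (k + 2) / (2 * fact k)"
    using assms fact_add_2_ge by (intro frac_le mult_right_mono) auto
  also have "\<dots> = s\<^sup>2 / 2 * ((A * \<bar>s\<bar>) ^ k / fact k)"
    by (simp add: power_add power_mult_distrib power2_eq_square)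
  finally show ?thesis .
qed

lemma exp_sums_real: "(\<lambda>k. y ^ k / fact k) sums exp (y::real)"
  using exp_converges[of y] by (simp add: divide_inverse mult.commute)

lemma cumul_sums:
  assumes "\<And>k. \<bar>m k\<bar> \<le> A ^ k" "A \<ge> 0"
  shows "(\<lambda>k. m k * s ^ (k + 2) / fact (k + 2)) sums cumul m s"
  unfolding cumul_def
proof (rule summable_sums, rule summable_comparison_test')
  show "summable (\<lambda>k. s\<^sup>2 / 2 * ((A * \<bar>s\<bar>) ^ k / fact k))"
    using sums_summable[OF exp_sums_real] by (rule summable_mult)
  show "norm (m k * s ^ (k + 2) / fact (k + 2)) \<le> s\<^sup>2 / 2 * ((A * \<bar>s\<bar>) ^ k / fact k)" for k
    unfolding real_norm_def using assms by (intro cumul_term_le)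
qed

lemma cumul_upper:
  assumes "\<And>k. 0 \<le> m k \<and> m k \<le> A ^ k" "A \<ge> 0" "s \<ge> 0"
  shows "cumul m s \<le> s\<^sup>2 / 2 * exp (A * s)"
proof (rule sums_le)
  show "(\<lambda>k. m k * s ^ (k + 2) / fact (k + 2)) sums cumul m s"
    using assms by (intro cumul_sums[of _ A]) auto
  show "(\<lambda>k. s\<^sup>2 / 2 * ((A * \<bar>s\<bar>) ^ k / fact k)) sums (s\<^sup>2 / 2 * exp (A * s))"
    using sums_mult[OF exp_sums_real, of "s\<^sup>2 / 2" "A * s"] assms by simp
  show "m k * s ^ (k + 2) / fact (k + 2) \<le> s\<^sup>2 / 2 * ((A * \<bar>s\<bar>) ^ k / fact k)" for k
    using assms by (intro order_trans[OF abs_ge_self cumul_term_le]) auto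
qed

lemma cumul_lower:
  assumes "\<And>k. 0 \<le> m k \<and> m k \<le> A ^ k" "A \<ge> 0" "s \<ge> 0" "m 0 = 1"
  shows "s\<^sup>2 / 2 \<le> cumul m s"
proof -
  have "sum (\<lambda>k. m k * s ^ (k + 2) / fact (k + 2)) {0} \<le> cumul m s"
    unfolding cumul_def using assms
    by (intro sum_le_suminf sums_summable[OF cumul_sums[of _ A]]) auto
  then show ?thesis using assms by (simp add: numeral_2_eq_2)
qed

text \<open>The main term at \<open>2 * s\<close> is \<open>2 * s\<^sup>2\<close>, and smallness of
  \<open>A * s\<close> costs at most a factor \<open>3 / 2\<close>. What matters is that 3 is below
  the 4 in the cut-off height \<open>4 * s * B\<^sup>2\<close>.\<close>

lemma cumul_le_3:
  assumes "\<And>k. 0 \<le> m k \<and> m k \<le> A ^ k" "A \<ge> 0" "s \<ge> 0" "A * (2 * s) \<le> 1 / 4"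
  shows "cumul m (2 * s) \<le> 3 * s\<^sup>2"
proof -
  define y where "y = A * (2 * s)"
  have y: "0 \<le> y" "y \<le> 1 / 4" using assms by (auto simp: y_def)
  have "exp y \<le> 1 + y + y\<^sup>2" using y by (intro exp_bound) auto
  also have "\<dots> \<le> 1 + 1/4 + (1/4)\<^sup>2" using y by (intro add_mono power_mono) auto
  also have "\<dots> \<le> 3 / 2" by (simp add: power2_eq_square)
  finally have e: "exp y \<le> 3 / 2" .
  have "cumul m (2 * s) \<le> (2 * s)\<^sup>2 / 2 * exp y"
    unfolding y_def using assms by (intro cumul_upper) auto
  also have "\<dots> \<le> (2 * s)\<^sup>2 / 2 * (3 / 2)" using e by (intro mult_left_mono) auto
  also have "\<dots> = 3 * s\<^sup>2" by (simp add: power2_eq_square)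
  finally show ?thesis .
qed

text \<open>The difference of the two cumulant functions is a power series whose coefficient of
  order \<open>k + 2\<close> is the difference of the \<open>k\<close>-th moments over
  \<open>fact (k + 2)\<close>; a forward difference of that order cancels the factorial. The factor
  \<open>exp A\<close> bounds the sum of all coefficients, hence the remainder.\<close>

lemma moment_diff_le:
  assumes m: "\<And>k. 0 \<le> m k \<and> m k \<le> A ^ k" and m': "\<And>k. 0 \<le> m' k \<and> m' k \<le> A ^ k"
    and A: "A \<ge> 0" and h: "0 \<le> h" "real (k + 2) * h \<le> 1"
    and D: "\<And>j. 1 \<le> j \<Longrightarrow> j \<le> k + 2 \<Longrightarrow> \<bar>cumul m (real j * h) - cumul m' (real j * h)\<bar> \<le> e"
    and e: "e \<ge> 0"
  shows "\<bar>m k - m' k\<bar> * h ^ (k + 2) \<le> 2 ^ (k + 2) * (e + exp A * (real (k + 2) * h) ^ (k + 3))"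
proof -
  define N where "N = k + 2"
  define a where "a j = (if j < 2 then 0 else (m (j - 2) - m' (j - 2)) / fact j)" for j
  define f where "f j = cumul m (real j * h) - cumul m' (real j * h)" for j
  have d: "\<bar>m k - m' k\<bar> \<le> A ^ k" for k
    using m[of k] m'[of k] by linarith
  have sm: "summable (\<lambda>j. norm (a j))" and S: "(\<Sum>j. norm (a j)) \<le> exp A"
  proof -
    have le: "norm (a (j + 2)) \<le> A ^ j / fact j" for j
    proof -
      have "norm (a (j + 2)) = \<bar>m j - m' j\<bar> / fact (j + 2)"
        by (simp add: a_def del: fact_Suc)
      also have "\<dots> \<le> A ^ j / fact j"
        using d[of j] A by (intro frac_le fact_mono) auto
      finally show ?thesis .
    qed
    have s2: "summable (\<lambda>j. norm (a (j + 2)))"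
      by (rule summable_comparison_test'[OF sums_summable[OF exp_sums_real[of A]], of 0])
        (use le in simp)
    then show *: "summable (\<lambda>j. norm (a j))" by (rule summable_iff_shift[THEN iffD1])
    have "(\<Sum>j. norm (a j)) = (\<Sum>j. norm (a (j + 2)))"
      using suminf_split_initial_segment[OF *, of 2] by (simp add: a_def numeral_2_eq_2)
    also have "\<dots> \<le> (\<Sum>j. A ^ j / fact j)"
      by (intro suminf_le le s2 sums_summable[OF exp_sums_real[of A]])
    also have "\<dots> = exp A" by (rule sums_unique[OF exp_sums_real, symmetric])
    finally show "(\<Sum>j. norm (a j)) \<le> exp A" .
  qed
  have sums: "(\<lambda>j. a j * s ^ j) sums (cumul m s - cumul m' s)" for s
  proof -
    have "(\<lambda>k. m k * s ^ (k + 2) / fact (k + 2) - m' k * s ^ (k + 2) / fact (k + 2)) sums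
        (cumul m s - cumul m' s)"
      using m m' A by (intro sums_diff cumul_sums[of _ A]) auto
    then have "(\<lambda>j. a (j + 2) * s ^ (j + 2)) sums (cumul m s - cumul m' s)"
      by (simp add: a_def left_diff_distrib diff_divide_distrib del: fact_Suc power_Suc)
    then show ?thesis
      by (subst (asm) sums_iff_shift) (simp add: a_def numeral_2_eq_2)
  qed
  have "norm ((\<Sum>j\<le>N. (-1) ^ j * of_nat (N choose j) * f j) - (-1) ^ N * fact N * a N * h ^ N)
      \<le> 2 ^ N * (exp A * (real N * h) ^ Suc N)"
  proof (rule finite_difference_coefficient[where c = 0])
    fix j assume j: "j \<le> N"
    have "real j * h \<le> real N * h" using j h by (intro mult_right_mono) auto
    then have jh: "0 \<le> real j * h" "real j * h \<le> 1" "real j * h \<le> real N * h"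
      using h by (auto simp: N_def)
    have "norm (f j - (\<Sum>i\<le>N. a i * (real j * h) ^ i)) \<le>
        (\<Sum>j. norm (a j)) * norm (real j * h) ^ Suc N"
      unfolding f_def using jh by (intro power_series_remainder_le sm sums) auto
    also have "\<dots> \<le> exp A * (real N * h) ^ Suc N"
      using jh S by (intro mult_mono power_mono) auto
    finally show "norm (f j - (\<Sum>i\<le>N. a i * ((0 + of_nat j) * h) ^ i)) \<le> exp A * (real N * h) ^ Suc N"
      by simp
  qed
  then have "norm ((-1) ^ N * fact N * a N * h ^ N) \<le>
      norm (\<Sum>j\<le>N. (-1) ^ j * of_nat (N choose j) * f j) + 2 ^ N * (exp A * (real N * h) ^ Suc N)"
    by (subst (asm) norm_minus_commute) (rule norm_le_of_norm_diff_le)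
  also have "norm (\<Sum>j\<le>N. (-1) ^ j * of_nat (N choose j) * f j) \<le> (\<Sum>j\<le>N. real (N choose j) * e)"
  proof (rule sum_norm_le)
    fix j assume "j \<in> {..N}"
    \<comment> \<open>The node \<open>j = 0\<close> lies outside the hypothesis \<open>D\<close>,
      but every \<open>cumul\<close> vanishes at 0.\<close>
    then have "\<bar>f j\<bar> \<le> e" using D[of j] e by (cases "j = 0") (auto simp: f_def N_def cumul_def)
    then show "norm ((-1) ^ j * of_nat (N choose j) * f j) \<le> real (N choose j) * e"
      by (simp add: abs_mult mult_left_mono)
  qed
  also have "\<dots> = 2 ^ N * e"
    using choose_row_sum[of N] by (simp flip: sum_distrib_right of_nat_sum)
  also have "norm ((-1) ^ N * fact N * a N * h ^ N) = \<bar>m k - m' k\<bar> * h ^ N"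
    using h by (simp add: abs_mult a_def N_def del: fact_Suc)
  finally show ?thesis by (simp add: N_def algebra_simps numeral_eq_Suc)
qed

text \<open>On a common bounded support, the Taylor polynomial of order \<open>K\<close>
  approximates every characteristic function with the same error, which tends to 0 with
  \<open>K\<close>. Convergent moments then give pointwise convergence of characteristic functions,
  and Levy's theorem applies.\<close>

lemma weak_conv_m_of_moments:
  assumes M: "\<And>n. real_distribution (M n)" and M': "real_distribution M'"
    and bM: "\<And>n. AE x in M n. \<bar>x\<bar> \<le> A" and bM': "AE x in M'. \<bar>x\<bar> \<le> A"
    and mom: "\<And>k. (\<lambda>n. \<integral>x. x ^ k \<partial>M n) \<longlonglongrightarrow> (\<integral>x. x ^ k \<partial>M')"
  shows "weak_conv_m M M'"
proof (rule levy_continuity[OF M M'])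
  fix t :: real
  have A: "A \<ge> 0"
  proof -
    interpret real_distribution M' by fact
    have "\<exists>x. \<bar>x\<bar> \<le> A" using bM' AE_False eventually_mono by (metis (mono_tags, lifting))
    then show ?thesis by linarith
  qed
  have approx: "cmod (char \<mu> t - (\<Sum>k\<le>K. ((\<i> * t) ^ k / fact k) * (\<integral>x. x ^ k \<partial>\<mu>))) \<le>
      2 * ((\<bar>t\<bar> * A) ^ K / fact K)"
    if "real_distribution \<mu>" and b: "AE x in \<mu>. \<bar>x\<bar> \<le> A" for \<mu> K
  proof -
    interpret real_distribution \<mu> by fact
    have pw: "AE x in \<mu>. \<bar>x\<bar> ^ k \<le> A ^ k" for k
      using b by eventually_elim (auto intro: power_mono)
    have int: "integrable \<mu> (\<lambda>x. x ^ k)" for k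
      by (rule integrable_const_bound[of _ "A ^ k"]) (use pw in \<open>simp_all add: power_abs\<close>)
    have "(\<integral>x. \<bar>x\<bar> ^ K \<partial>\<mu>) \<le> (\<integral>x. A ^ K \<partial>\<mu>)"
      using pw int[of K] by (intro integral_mono_AE) (auto simp flip: power_abs)
    also have "\<dots> = A ^ K" using prob_space by simp
    finally have "(2 * \<bar>t\<bar> ^ K / fact K) * (\<integral>x. \<bar>x\<bar> ^ K \<partial>\<mu>) \<le> (2 * \<bar>t\<bar> ^ K / fact K) * A ^ K"
      by (intro mult_left_mono) auto
    with char_approx1[of K t, OF int] show ?thesis by (simp add: power_mult_distrib)
  qed
  show "(\<lambda>n. char (M n) t) \<longlonglongrightarrow> char M' t"
  proof (rule LIMSEQ_I)
    fix r :: real assume r: "r > 0"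
    have "(\<lambda>K. (\<bar>t\<bar> * A) ^ K / fact K) \<longlonglongrightarrow> 0"
      using sums_summable[OF exp_sums_real] by (rule summable_LIMSEQ_zero)
    then have "\<forall>\<^sub>F K in sequentially. (\<bar>t\<bar> * A) ^ K / fact K < r / 6"
      using r by (intro order_tendstoD) auto
    then obtain K where K: "(\<bar>t\<bar> * A) ^ K / fact K < r / 6"
      by (meson eventually_False_sequentially eventually_mono)
    define T where "T \<mu> = (\<Sum>k\<le>K. ((\<i> * t) ^ k / fact k) * complex_of_real (\<integral>x. x ^ k \<partial>\<mu>))"
      for \<mu> :: "real measure"
    have "(\<lambda>n. T (M n)) \<longlonglongrightarrow> T M'"
      unfolding T_def by (intro tendsto_intros mom)
    then obtain n0 where n0: "\<And>n. n \<ge> n0 \<Longrightarrow> norm (T (M n) - T M') < r / 3"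
      using LIMSEQ_D[of "\<lambda>n. T (M n)" "T M'" "r / 3"] r by auto
    have "norm (char (M n) t - char M' t) < r" if n: "n \<ge> n0" for n
    proof -
      have 1: "norm (char (M n) t - T (M n)) < r / 3"
        using approx[OF M bM, of n K] K unfolding T_def by linarith
      have 2: "norm (char M' t - T M') < r / 3"
        using approx[OF M' bM', of K] K unfolding T_def by linarith
      have "char (M n) t - char M' t = (char (M n) t - T (M n)) + (T (M n) - T M') - (char M' t - T M')"
        by simp
      also have "norm \<dots> \<le> norm (char (M n) t - T (M n)) + norm (T (M n) - T M') + norm (char M' t - T M')"
        by (meson add_mono norm_triangle_ineq norm_triangle_ineq4 order.trans order_refl)
      also have "\<dots> < r" using 1 2 n0[OF n] by linarith
      finally show ?thesis .
    qed
    then show "\<exists>no. \<forall>n\<ge>no. norm (char (M n) t - char M' t) < r" by blast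
  qed
qed

text \<open>With \<open>q = exp (u * s\<^sup>2 / 4)\<close>, the parts below and above the window
  are each at most \<open>q\<close>, whereas \<open>E\<close> is at least
  \<open>c * q\<^sup>2\<close>, hence at least \<open>4 * q\<close>. They make up at most half of
  \<open>E\<close>, and moving them to the left doubles the constant 4.\<close>

lemma exp_moment_absorb:
  fixes c s u b E E' F :: real
  assumes E: "E \<le> exp (s * b) + 4 * exp 1 * E' + exp (- s * (4 * s * u)) * F"
    and F: "F \<le> exp (u * (3 * s\<^sup>2))" and b: "s * b \<le> u * s\<^sup>2 / 4" and u: "u \<ge> 0"
    and c: "c > 0" "4 / c \<le> exp (u * s\<^sup>2 / 4)" and low: "c * exp (u * s\<^sup>2 / 2) \<le> E"
  shows "E \<le> 8 * exp 1 * E'"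
proof -
  define q where "q = exp (u * s\<^sup>2 / 4)"
  have q1: "q \<ge> 1" using u by (simp add: q_def)
  have "exp (s * b) \<le> q" using b by (simp add: q_def)
  moreover have "exp (- s * (4 * s * u)) * F \<le> q"
  proof -
    have "exp (- s * (4 * s * u)) * F \<le> exp (- s * (4 * s * u)) * exp (u * (3 * s\<^sup>2))"
      using F by (intro mult_left_mono) auto
    also have "\<dots> = exp (- (u * s\<^sup>2))" by (simp add: power2_eq_square algebra_simps flip: exp_add)
    also have "\<dots> \<le> 1" using u by simp
    finally show ?thesis using q1 by linarith
  qed
  moreover have "2 * q \<le> E / 2"
  proof -
    have "4 \<le> c * q" using c by (simp add: q_def field_simps)
    then have "4 * q \<le> c * q * q" using q1 by (intro mult_right_mono) auto
    also have "\<dots> = c * exp (u * s\<^sup>2 / 2)" by (simp add: q_def flip: exp_add)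
    finally show ?thesis using low by linarith
  qed
  ultimately show ?thesis using E by linarith
qed

section \<open>Exponential moments of the limit law and of additive functions\<close>

text \<open>Dividing the series of \<open>exp (z * x) - z * x - 1\<close> by
  \<open>x\<^sup>2\<close> leaves powers of \<open>x\<close>, integrated term by term under the
  bound \<open>(cmod z)\<^sup>2 * exp (cmod z * \<alpha>)\<close>. Complex \<open>z\<close> is
  allowed so that the Kolmogorov integral becomes an entire function.\<close>

lemma kolmogorov_integral_sums:
  fixes z :: complex
  assumes "prob_space \<nu>" and [measurable_cong]: "sets \<nu> = sets borel"
    and supp: "AE x in \<nu>. 0 < x \<and> x \<le> \<alpha>"
  shows "(\<lambda>k. z ^ (k + 2) / fact (k + 2) * of_real (\<integral>x. x ^ k \<partial>\<nu>)) sums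
    (LINT x:{0<..}|\<nu>. (exp (z * of_real x) - z * of_real x - 1) / (of_real x)\<^sup>2)"
proof -
  interpret prob_space \<nu> by fact
  define S where "S n x = (\<Sum>k<n. z ^ (k + 2) / fact (k + 2) * complex_of_real (x ^ k))"
    for n :: nat and x :: real
  have bd: "cmod (z ^ (k + 2) / fact (k + 2) * complex_of_real (x ^ k)) \<le> (cmod z)\<^sup>2 * ((cmod z * \<alpha>) ^ k / fact k)"
    if x: "0 < x" "x \<le> \<alpha>" for x k
  proof -
    have "cmod (z ^ (k + 2) / fact (k + 2) * complex_of_real (x ^ k)) = cmod z ^ (k + 2) * x ^ k / fact (k + 2)"
      using x by (simp add: norm_mult norm_divide norm_power del: fact_Suc)
    also have "\<dots> \<le> cmod z ^ (k + 2) * \<alpha> ^ k / fact k"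
      using x by (intro frac_le mult_left_mono power_mono fact_mono) auto
    also have "\<dots> = (cmod z)\<^sup>2 * ((cmod z * \<alpha>) ^ k / fact k)"
      by (simp add: power_add power_mult_distrib power2_eq_square)
    finally show ?thesis .
  qed
  have int: "integrable \<nu> (\<lambda>x. z ^ (k + 2) / fact (k + 2) * complex_of_real (x ^ k))" for k
  proof (rule integrable_const_bound)
    show "AE x in \<nu>. cmod (z ^ (k + 2) / fact (k + 2) * complex_of_real (x ^ k)) \<le>
        (cmod z)\<^sup>2 * ((cmod z * \<alpha>) ^ k / fact k)"
      using supp by eventually_elim (rule bd, auto)
  qed simp
  have "(\<lambda>n. \<integral>x. S n x \<partial>\<nu>) \<longlonglongrightarrow>
      (LINT x:{0<..}|\<nu>. (exp (z * of_real x) - z * of_real x - 1) / (of_real x)\<^sup>2)"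
    unfolding set_lebesgue_integral_def
  proof (rule integral_dominated_convergence)
    show "AE x in \<nu>. (\<lambda>n. S n x) \<longlonglongrightarrow> indicat_real {0<..} x *\<^sub>R
        ((exp (z * of_real x) - z * of_real x - 1) / (of_real x)\<^sup>2)"
      using supp
    proof eventually_elim
      case (elim x)
      have "(\<lambda>k. (z * of_real x) ^ (k + 2) / fact (k + 2) / (of_real x)\<^sup>2) sums
          ((exp (z * of_real x) - 1 - z * of_real x) / (of_real x)\<^sup>2)"
        by (intro sums_divide exp_remainder_sums)
      also have "(\<lambda>k. (z * complex_of_real x) ^ (k + 2) / fact (k + 2) / (of_real x)\<^sup>2) =
          (\<lambda>k. z ^ (k + 2) / fact (k + 2) * complex_of_real (x ^ k))"
      proof
        fix k
        have "(z * complex_of_real x) ^ (k + 2) = z ^ (k + 2) * of_real (x ^ k) * (of_real x)\<^sup>2"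
          by (simp add: power_mult_distrib power_add power2_eq_square mult_ac)
        then show "(z * complex_of_real x) ^ (k + 2) / fact (k + 2) / (of_real x)\<^sup>2 =
          z ^ (k + 2) / fact (k + 2) * complex_of_real (x ^ k)"
          using elim by (simp del: fact_Suc power_Suc)
      qed
      finally show ?case
        using elim by (simp add: sums_def S_def algebra_simps del: fact_Suc power_Suc)
    qed
    show "AE x in \<nu>. norm (S n x) \<le> (cmod z)\<^sup>2 * exp (cmod z * \<alpha>)" for n
      using supp
    proof eventually_elim
      case (elim x)
      have "norm (S n x) \<le> (\<Sum>k<n. (cmod z)\<^sup>2 * ((cmod z * \<alpha>) ^ k / fact k))"
        unfolding S_def using elim by (intro sum_norm_le bd) auto
      also have "\<dots> = (cmod z)\<^sup>2 * (\<Sum>k<n. (cmod z * \<alpha>) ^ k / fact k)"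
        by (simp add: sum_distrib_left)
      also have "\<dots> \<le> (cmod z)\<^sup>2 * (\<Sum>k. (cmod z * \<alpha>) ^ k / fact k)"
        using elim by (intro mult_left_mono sum_le_suminf sums_summable[OF exp_sums_real]) auto
      also have "(\<Sum>k. (cmod z * \<alpha>) ^ k / fact k) = exp (cmod z * \<alpha>)"
        by (rule sums_unique[OF exp_sums_real, symmetric])
      finally show ?case .
    qed
  qed (simp_all add: S_def del: fact_Suc power_Suc)
  moreover have "(\<integral>x. S n x \<partial>\<nu>) = (\<Sum>k<n. z ^ (k + 2) / fact (k + 2) * of_real (\<integral>x. x ^ k \<partial>\<nu>))" for n
    unfolding S_def using int
    by (simp only: Bochner_Integration.integral_sum integral_mult_right_zero integral_complex_of_real)
  ultimately show ?thesis by (simp add: sums_def)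
qed

lemma moment_bounds:
  fixes \<nu> :: "real measure"
  assumes "prob_space \<nu>" and [measurable_cong]: "sets \<nu> = sets borel"
    and supp: "AE x in \<nu>. 0 \<le> x \<and> x \<le> \<alpha>"
  shows "0 \<le> (\<integral>x. x ^ k \<partial>\<nu>) \<and> (\<integral>x. x ^ k \<partial>\<nu>) \<le> \<alpha> ^ k"
proof -
  interpret prob_space \<nu> by fact
  have pw: "AE x in \<nu>. 0 \<le> x ^ k \<and> x ^ k \<le> \<alpha> ^ k"
    using supp by eventually_elim (auto intro: power_mono)
  have int: "integrable \<nu> (\<lambda>x. x ^ k)"
    by (rule integrable_const_bound[of _ "\<alpha> ^ k"]) (use pw in auto)
  have "(\<integral>x. x ^ k \<partial>\<nu>) \<le> (\<integral>x. \<alpha> ^ k \<partial>\<nu>)"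
    using pw int by (intro integral_mono_AE) auto
  then have "(\<integral>x. x ^ k \<partial>\<nu>) \<le> \<alpha> ^ k" using prob_space by simp
  moreover have "0 \<le> (\<integral>x. x ^ k \<partial>\<nu>)" using pw by (intro integral_nonneg_AE) auto
  ultimately show ?thesis by simp
qed

section \<open>The limit law and its exponential moments\<close>

lemma distribution_function_measure:
  assumes "distribution_function \<Psi>"
  shows "real_distribution (interval_measure \<Psi>)" "cdf (interval_measure \<Psi>) = \<Psi>"
proof -
  have "mono \<Psi>" and *: "\<And>a. continuous (at_right a) \<Psi>" "(\<Psi> \<longlongrightarrow> 0) at_bot" "(\<Psi> \<longlongrightarrow> 1) at_top"
    using assms by (auto simp: distribution_function_def)
  then have m: "\<And>x y. x \<le> y \<Longrightarrow> \<Psi> x \<le> \<Psi> y" by (auto simp: mono_def)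
  show "real_distribution (interval_measure \<Psi>)"
    by (rule real_distribution_interval_measure[OF m *])
  show "cdf (interval_measure \<Psi>) = \<Psi>"
    by (rule cdf_interval_measure[OF m *(1,2)])
qed

lemma distribution_function_support:
  assumes "distribution_function \<Psi>" and "\<alpha> > 0" "\<Psi> \<alpha> - \<Psi> 0 = 1"
  shows "AE x in interval_measure \<Psi>. 0 < x \<and> x \<le> \<alpha>"
proof -
  interpret real_distribution "interval_measure \<Psi>"
    using assms(1) by (rule distribution_function_measure)
  have "measure (interval_measure \<Psi>) {0<..\<alpha>} = \<Psi> \<alpha> - \<Psi> 0"
    using assms by (intro measure_interval_measure_Ioc) (auto simp: distribution_function_def mono_def)
  then have "AE x in interval_measure \<Psi>. x \<in> {0<..\<alpha>}"
    using assms by (intro prob_eq_1[THEN iffD1]) auto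
  then show ?thesis by simp
qed

text \<open>The exponent of the characteristic function is \<open>u\<close> times an entire function
  taken at \<open>\<i> * t\<close>, so \<open>exp_moment_of_entire_char\<close> applies. At real
  points that entire function is \<open>cumul\<close> of the moments of the measure.\<close>

lemma Z_exp_moment:
  assumes \<Psi>: "distribution_function \<Psi>" "\<alpha> > 0" "\<Psi> \<alpha> - \<Psi> 0 = 1"
    and "prob_space P" "Z_family P \<Psi> Z" and u: "u \<ge> 0"
  shows "integrable P (\<lambda>w. exp (s * Z u w))"
    and "(\<integral>w. exp (s * Z u w) \<partial>P) = exp (u * cumul (\<lambda>k. \<integral>x. x ^ k \<partial>interval_measure \<Psi>) s)"
proof -
  interpret P: prob_space P by fact
  interpret \<nu>: real_distribution "interval_measure \<Psi>"
    using \<Psi>(1) by (rule distribution_function_measure)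
  note supp = distribution_function_support[OF \<Psi>]
  define m where "m k = (\<integral>x. x ^ k \<partial>interval_measure \<Psi>)" for k
  have m: "\<bar>m k\<bar> \<le> \<alpha> ^ k" for k
  proof -
    have "AE x in interval_measure \<Psi>. 0 \<le> x \<and> x \<le> \<alpha>" using supp by eventually_elim auto
    then show ?thesis
      using moment_bounds[of "interval_measure \<Psi>" \<alpha> k] \<nu>.prob_space_axioms
      unfolding m_def by auto
  qed
  have Z[measurable]: "Z u \<in> borel_measurable P" and
    ch: "\<And>t. char (distr P borel (Z u)) t = exp (complex_of_real u *
             (LINT x:{0<..}|interval_measure \<Psi>.
                (exp (\<i> * complex_of_real t * complex_of_real x)
                   - \<i> * complex_of_real t * complex_of_real x - 1) / (complex_of_real x)\<^sup>2))"
    using assms unfolding Z_family_def by auto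
  define K where "K z = (LINT x:{0<..}|interval_measure \<Psi>.
      (exp (z * complex_of_real x) - z * complex_of_real x - 1) / (complex_of_real x)\<^sup>2)" for z
  have K: "(\<lambda>k. z ^ (k + 2) / fact (k + 2) * of_real (m k)) sums K z" for z
    unfolding K_def m_def
    using supp \<nu>.prob_space_axioms by (intro kolmogorov_integral_sums[of _ \<alpha>]) auto
  have K_real: "K (of_real s) = of_real (cumul m s)" for s
  proof -
    have "(\<lambda>k. complex_of_real (m k * s ^ (k + 2) / fact (k + 2))) sums of_real (cumul m s)"
      using m \<Psi>(2) by (intro sums_of_real cumul_sums[of _ \<alpha>]) auto
    moreover have "(\<lambda>k. complex_of_real (m k * s ^ (k + 2) / fact (k + 2))) =
        (\<lambda>k. of_real s ^ (k + 2) / fact (k + 2) * of_real (m k))"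
      by (intro ext) (simp add: mult.commute del: fact_Suc power_Suc)
    ultimately show ?thesis using K[of "of_real s"] by (metis sums_unique2)
  qed
  have hol: "K holomorphic_on ball 0 r" for r
  proof (rule power_series_holomorphic)
    fix z :: complex
    define a where "a j = (if j < 2 then 0 else complex_of_real (m (j - 2)) / fact j)" for j
    have "(\<lambda>j. a (j + 2) * z ^ (j + 2)) sums K z"
      using K[of z] by (simp add: a_def mult.commute del: fact_Suc power_Suc)
    then have "(\<lambda>j. a j * z ^ j) sums K z"
      by (subst (asm) sums_iff_shift) (simp add: a_def numeral_2_eq_2)
    then show "(\<lambda>j. (if j < 2 then 0 else complex_of_real (m (j - 2)) / fact j) * (z - 0) ^ j) sums K z"
      by (simp add: a_def)
  qed
  define G where "G z = exp (of_real u * K z)" for z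
  \<comment> \<open>The disc depends on \<open>z\<close>, but the Taylor coefficients at 0 do not,
    so one coefficient sequence serves the whole plane.\<close>
  have G: "(\<lambda>j. (deriv ^^ j) G 0 / fact j * z ^ j) sums G z" for z
  proof -
    have "G holomorphic_on ball 0 (norm z + 1)"
      unfolding G_def by (intro holomorphic_intros hol)
    from holomorphic_power_series[OF this, of z] show ?thesis by simp
  qed
  have D: "real_distribution (distr P borel (Z u))" by (rule P.real_distribution_distr) (rule Z)
  have chG: "char (distr P borel (Z u)) t = G (\<i> * of_real t)" for t
    unfolding ch G_def K_def ..
  have "integrable (distr P borel (Z u)) (\<lambda>x. exp (s * x))"
    by (rule exp_moment_of_entire_char(1)[OF D G chG])
  then show "integrable P (\<lambda>w. exp (s * Z u w))"
    by (subst (asm) integrable_distr_eq) auto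
  have "complex_of_real (\<integral>x. exp (s * x) \<partial>distr P borel (Z u)) = G (of_real s)"
    by (rule exp_moment_of_entire_char(2)[OF D G chG])
  also have "\<dots> = complex_of_real (exp (u * cumul m s))"
    unfolding G_def K_real by (simp add: exp_of_real flip: of_real_mult)
  also have "(\<integral>x. exp (s * x) \<partial>distr P borel (Z u)) = (\<integral>w. exp (s * Z u w) \<partial>P)"
    by (subst integral_distr) auto
  finally show "(\<integral>w. exp (s * Z u w) \<partial>P) = exp (u * cumul (\<lambda>k. \<integral>x. x ^ k \<partial>interval_measure \<Psi>) s)"
    by (simp only: of_real_eq_iff m_def)
qed

text \<open>The \<open>k\<close>-th moment of the law that puts mass
  \<open>(g p)\<^sup>2 / (p * B\<^sup>2)\<close> at \<open>g p\<close>, with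
  \<open>B = add_dev g x\<close>. Its distribution function is the quotient whose limit the theorem
  determines.\<close>

definition add_moment :: "(nat \<Rightarrow> real) \<Rightarrow> real \<Rightarrow> nat \<Rightarrow> real" where
  "add_moment g x k = (\<Sum>p\<in>primes_upto x. (g p)\<^sup>2 / real p * g p ^ k) / (add_dev g x)\<^sup>2"

lemma add_dev_square: "(add_dev g x)\<^sup>2 = (\<Sum>p\<in>primes_upto x. (g p)\<^sup>2 / real p)"
  by (simp add: add_dev_def sum_nonneg)

lemma add_moment_bounds:
  assumes g: "\<And>p. prime p \<Longrightarrow> 0 \<le> g p \<and> g p \<le> M" and "add_dev g x > 0"
  shows "0 \<le> add_moment g x k \<and> add_moment g x k \<le> M ^ k"
proof -
  have "(\<Sum>p\<in>primes_upto x. (g p)\<^sup>2 / real p * g p ^ k) \<le> (\<Sum>p\<in>primes_upto x. (g p)\<^sup>2 / real p * M ^ k)"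
    using g by (intro sum_mono mult_left_mono power_mono) (auto simp: primes_upto_def)
  also have "\<dots> = (add_dev g x)\<^sup>2 * M ^ k" by (simp add: add_dev_square sum_distrib_right)
  finally have "add_moment g x k \<le> M ^ k"
    using assms(2) by (simp add: add_moment_def field_simps)
  moreover have "0 \<le> add_moment g x k"
    using g unfolding add_moment_def
    by (intro divide_nonneg_nonneg sum_nonneg mult_nonneg_nonneg) (auto simp: primes_upto_def)
  ultimately show ?thesis by simp
qed

text \<open>Expand the exponential for each prime; every term of order at least 2 contains the
  weight \<open>(g p)\<^sup>2 / p\<close>. The linear term is left out on the right because it
  cancels against the centring by \<open>add_mean\<close>.\<close>

lemma cumul_add_moment:
  assumes g: "\<And>p. prime p \<Longrightarrow> 0 \<le> g p \<and> g p \<le> M" and B: "add_dev g x > 0"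
  shows "(add_dev g x)\<^sup>2 * cumul (add_moment g x) s =
    (\<Sum>p\<in>primes_upto x. (exp (s * g p) - 1 - s * g p) / real p)"
proof -
  have "(\<lambda>k. \<Sum>p\<in>primes_upto x. (s * g p) ^ (k + 2) / fact (k + 2) / real p) sums
      (\<Sum>p\<in>primes_upto x. (exp (s * g p) - 1 - s * g p) / real p)"
    by (intro sums_sum sums_divide exp_remainder_sums)
  moreover have "(\<Sum>p\<in>primes_upto x. (s * g p) ^ (k + 2) / fact (k + 2) / real p) =
      (add_dev g x)\<^sup>2 * (add_moment g x k * s ^ (k + 2) / fact (k + 2))" for k
  proof -
    have pw: "(s * g p) ^ (k + 2) = (g p)\<^sup>2 * g p ^ k * s ^ (k + 2)" for p
      by (simp add: power_mult_distrib power_add power2_eq_square)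
    have "(\<Sum>p\<in>primes_upto x. (s * g p) ^ (k + 2) / fact (k + 2) / real p) =
        (\<Sum>p\<in>primes_upto x. (g p)\<^sup>2 / real p * g p ^ k) * (s ^ (k + 2) / fact (k + 2))"
      unfolding sum_distrib_right pw by (intro sum.cong refl) (simp add: mult_ac)
    also have "(\<Sum>p\<in>primes_upto x. (g p)\<^sup>2 / real p * g p ^ k) = (add_dev g x)\<^sup>2 * add_moment g x k"
      using B by (simp add: add_moment_def)
    finally show ?thesis by (simp del: fact_Suc power_Suc)
  qed
  moreover have "M \<ge> 0" using g[of 2] by (auto simp: two_is_prime_nat)
  then have "(\<lambda>k. add_moment g x k * s ^ (k + 2) / fact (k + 2)) sums cumul (add_moment g x) s"
    using add_moment_bounds[OF g B] by (intro cumul_sums[of _ M]) auto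
  then have "(\<lambda>k. (add_dev g x)\<^sup>2 * (add_moment g x k * s ^ (k + 2) / fact (k + 2))) sums
      ((add_dev g x)\<^sup>2 * cumul (add_moment g x) s)"
    by (rule sums_mult)
  ultimately show ?thesis by (metis (no_types, lifting) sums_cong sums_unique2)
qed

text \<open>The two Euler product bounds, for \<open>1 + h p = exp (s * g p)\<close>. Restricting to
  \<open>s \<le> 1\<close> bounds \<open>h p\<close> by \<open>exp M - 1\<close>, so that
  \<open>c\<close> and \<open>X\<close> do not depend on \<open>s\<close>.\<close>

lemma add_exp_moment:
  assumes g: "strongly_additive g" and gM: "\<And>p. prime p \<Longrightarrow> 0 \<le> g p \<and> g p \<le> M"
  obtains c X where "0 < c" "c \<le> 1" "X > 0"
    "\<And>x s. x \<ge> X \<Longrightarrow> add_dev g x > 0 \<Longrightarrow> 0 \<le> s \<Longrightarrow> s \<le> 1 \<Longrightarrow>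
      c * exp ((add_dev g x)\<^sup>2 * cumul (add_moment g x) s) \<le>
        (\<Sum>n\<in>posints_upto x. exp (s * (g n - add_mean g x))) / x \<and>
      (\<Sum>n\<in>posints_upto x. exp (s * (g n - add_mean g x))) / x \<le>
        exp ((add_dev g x)\<^sup>2 * cumul (add_moment g x) s)"
proof -
  have M: "M \<ge> 0" using gM[of 2] by (auto simp: two_is_prime_nat)
  then have "exp M - 1 \<ge> 0" by simp
  from sum_mult_fun_ge[OF this] obtain c X where c: "c > 0" and
    low: "\<And>x h. x \<ge> X \<Longrightarrow> (\<And>p. prime p \<Longrightarrow> 0 \<le> h p \<and> h p \<le> exp M - 1) \<Longrightarrow>
      c * x * exp (\<Sum>p\<in>primes_upto x. h p / real p)
        \<le> (\<Sum>n\<in>posints_upto x. \<Prod>p\<in>prime_factors n. (1 + h p))" by blast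
  have "min c 1 * exp ((add_dev g x)\<^sup>2 * cumul (add_moment g x) s) \<le>
        (\<Sum>n\<in>posints_upto x. exp (s * (g n - add_mean g x))) / x \<and>
      (\<Sum>n\<in>posints_upto x. exp (s * (g n - add_mean g x))) / x \<le>
        exp ((add_dev g x)\<^sup>2 * cumul (add_moment g x) s)"
    if x: "x \<ge> max X 1" and B: "add_dev g x > 0" and s: "0 \<le> s" "s \<le> 1" for x s
  proof -
    define h where "h p = exp (s * g p) - 1" for p
    have h: "0 \<le> h p \<and> h p \<le> exp M - 1" if "prime p" for p
    proof -
      have "s * g p \<le> 1 * M" using gM[OF that] s by (intro mult_mono) auto
      then show ?thesis using gM[OF that] s by (simp add: h_def)
    qed
    define S where "S = (\<Sum>n\<in>posints_upto x. \<Prod>p\<in>prime_factors n. (1 + h p))"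
    define H where "H = (\<Sum>p\<in>primes_upto x. h p / real p)"
    have "exp (s * (g n - add_mean g x)) = exp (- s * add_mean g x) * (\<Prod>p\<in>prime_factors n. (1 + h p))"
      if "n \<in> posints_upto x" for n
    proof -
      have "g n = (\<Sum>p\<in>prime_factors n. g p)"
        using that by (intro strongly_additive_eq_sum g) (simp add: posints_upto_def)
      then have "exp (s * g n) = (\<Prod>p\<in>prime_factors n. (1 + h p))"
        by (simp add: h_def sum_distrib_left exp_sum)
      then show ?thesis by (simp add: right_diff_distrib exp_diff exp_minus divide_inverse)
    qed
    then have eq: "(\<Sum>n\<in>posints_upto x. exp (s * (g n - add_mean g x))) = exp (- s * add_mean g x) * S"
      by (simp add: S_def sum_distrib_left)
    have "- s * add_mean g x + H = (add_dev g x)\<^sup>2 * cumul (add_moment g x) s"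
      using cumul_add_moment[OF gM B, of s]
      by (simp add: H_def h_def add_mean_def sum_distrib_left diff_divide_distrib sum_subtractf sum_negf)
    then have Heq: "exp (- s * add_mean g x) * exp H = exp ((add_dev g x)\<^sup>2 * cumul (add_moment g x) s)"
      by (simp only: flip: exp_add)
    have "S \<le> x * exp H"
      unfolding S_def H_def using h x by (intro sum_mult_fun_le) auto
    then have "exp (- s * add_mean g x) * S \<le> exp (- s * add_mean g x) * (x * exp H)"
      by (intro mult_left_mono) auto
    then have up: "exp (- s * add_mean g x) * S / x \<le> exp (- s * add_mean g x) * exp H"
      using x by (simp add: field_simps)
    have "c * x * exp H \<le> S" unfolding S_def H_def using h x by (intro low) auto
    then have "exp (- s * add_mean g x) * (c * x * exp H) \<le> exp (- s * add_mean g x) * S"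
      by (intro mult_left_mono) auto
    then have "c * (exp (- s * add_mean g x) * exp H) \<le> exp (- s * add_mean g x) * S / x"
      using x by (simp add: field_simps)
    moreover have "min c 1 * (exp (- s * add_mean g x) * exp H) \<le> c * (exp (- s * add_mean g x) * exp H)"
      by (intro mult_right_mono) auto
    ultimately have "min c 1 * (exp (- s * add_mean g x) * exp H) \<le> exp (- s * add_mean g x) * S / x"
      by linarith
    then show ?thesis using up unfolding eq Heq by blast
  qed
  with c show ?thesis by (intro that[of "min c 1" "max X 1"]) auto
qed

section \<open>Comparison of moments\<close>

text \<open>Stated for two abstract variables because it is used in both directions, with the
  additive function and \<open>Z\<close> exchanging roles. Only the variable being bounded needs
  cumulant estimates, and its lower estimate may lose a factor \<open>c\<close>.\<close>

lemma exp_moment_window: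
  fixes X :: "'a \<Rightarrow> real" and Y :: "'b \<Rightarrow> real"
  assumes N: "finite_measure N1" "finite_measure N2" and mass: "measure N1 (space N1) \<le> 1"
    and X: "X \<in> borel_measurable N1" and Y: "Y \<in> borel_measurable N2"
    and iX: "\<And>r. integrable N1 (\<lambda>w. exp (r * X w))" and iY: "\<And>r. integrable N2 (\<lambda>w. exp (r * Y w))"
    and m: "\<And>k. 0 \<le> m k \<and> m k \<le> A ^ k" "m 0 = 1" and A: "A \<ge> 0"
    and low: "c * exp (B\<^sup>2 * cumul m s) \<le> (\<integral>w. exp (s * X w) \<partial>N1)"
    and up: "(\<integral>w. exp (2 * s * X w) \<partial>N1) \<le> exp (B\<^sup>2 * cumul m (2 * s))"
    and tails: "\<And>v. B \<le> v \<Longrightarrow> v \<le> 4 * s * B\<^sup>2 \<Longrightarrow>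
      measure N1 {w \<in> space N1. v \<le> X w} \<le> 2 * measure N2 {w \<in> space N2. v \<le> Y w}"
    and s: "s > 0" "A * (2 * s) \<le> 1 / 4" and B: "B > 0" "4 \<le> s * B"
    and c: "c > 0" "4 / c \<le> exp (B\<^sup>2 * s\<^sup>2 / 4)"
  shows "(\<integral>w. exp (s * X w) \<partial>N1) \<le> 8 * exp 1 * (\<integral>w. exp (s * Y w) \<partial>N2)"
proof (rule exp_moment_absorb)
  show "(\<integral>w. exp (s * X w) \<partial>N1) \<le> exp (s * B) + 4 * exp 1 * (\<integral>w. exp (s * Y w) \<partial>N2) +
      exp (- s * (4 * s * B\<^sup>2)) * (\<integral>w. exp (2 * s * X w) \<partial>N1)"
    by (rule exp_moment_le_of_tail_le[OF N mass X Y s(1) iX iX iY tails])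
  have "exp (B\<^sup>2 * cumul m (2 * s)) \<le> exp (B\<^sup>2 * (3 * s\<^sup>2))"
    using cumul_le_3[OF m(1) A _ s(2)] s by (simp add: mult_left_mono)
  with up show "(\<integral>w. exp (2 * s * X w) \<partial>N1) \<le> exp (B\<^sup>2 * (3 * s\<^sup>2))" by linarith
  have "(s * B) * 4 \<le> (s * B) * (s * B)" using B s by (intro mult_left_mono) auto
  then show "s * B \<le> B\<^sup>2 * s\<^sup>2 / 4" by (simp add: power2_eq_square mult_ac)
  have "B\<^sup>2 * (s\<^sup>2 / 2) \<le> B\<^sup>2 * cumul m s"
    using cumul_lower[OF m(1) A _ m(2)] s by (intro mult_left_mono) auto
  then have "c * exp (B\<^sup>2 * s\<^sup>2 / 2) \<le> c * exp (B\<^sup>2 * cumul m s)" using c by simp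
  with low show "c * exp (B\<^sup>2 * s\<^sup>2 / 2) \<le> (\<integral>w. exp (s * X w) \<partial>N1)" by linarith
qed (use c in auto)

lemma add_moment_tendsto:
  fixes P :: "'w measure"
  assumes g: "strongly_additive g" and gM: "\<And>p. prime p \<Longrightarrow> 0 \<le> g p \<and> g p \<le> M"
    and lim: "filterlim (add_dev g) at_top at_top"
    and \<Psi>: "distribution_function \<Psi>" "\<alpha> > 0" "\<Psi> \<alpha> - \<Psi> 0 = 1"
    and P: "prob_space P" and Z: "Z_family P \<Psi> Z"
    and freq: "\<And>\<epsilon> c \<eta> :: real. \<epsilon> > 0 \<Longrightarrow> c > 0 \<Longrightarrow> \<eta> > 0 \<Longrightarrow>
      \<forall>\<^sub>F x in at_top. \<forall>\<Delta>. 1 \<le> \<Delta> \<and> \<Delta> \<le> c * add_dev g x powr (1 - \<epsilon>) \<longrightarrow>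
        \<bar>upper_freq g x \<Delta> /
          measure P {w \<in> space P. Z ((add_dev g x)\<^sup>2) w \<ge> \<Delta> * add_dev g x} - 1\<bar> < \<eta>"
  shows "((\<lambda>x. add_moment g x k) \<longlongrightarrow> (\<integral>y. y ^ k \<partial>interval_measure \<Psi>)) at_top"
proof -
  interpret P: prob_space P by fact
  interpret \<nu>: real_distribution "interval_measure \<Psi>"
    using \<Psi>(1) by (rule distribution_function_measure)
  define m' where "m' k = (\<integral>y. y ^ k \<partial>interval_measure \<Psi>)" for k
  define N where "N = k + 2"
  define A where "A = max M \<alpha>"
  have M: "M \<ge> 0" using gM[of 2] by (auto simp: two_is_prime_nat)
  have A: "A > 0" "A \<ge> M" "A \<ge> \<alpha>" using \<Psi>(2) by (auto simp: A_def)
  have m': "0 \<le> m' k \<and> m' k \<le> A ^ k" for k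
  proof -
    have "AE y in interval_measure \<Psi>. 0 \<le> y \<and> y \<le> A"
      using distribution_function_support[OF \<Psi>] by eventually_elim (use A in auto)
    then show ?thesis
      using moment_bounds[of "interval_measure \<Psi>" A k] \<nu>.prob_space_axioms unfolding m'_def by auto
  qed
  have m'0: "m' 0 = 1" using \<nu>.prob_space by (simp add: m'_def)
  have m: "0 \<le> add_moment g x k \<and> add_moment g x k \<le> A ^ k" if "add_dev g x > 0" for x k
    using add_moment_bounds[OF gM that, of k] power_mono[OF A(2) M, of k] by linarith
  have m0: "add_moment g x 0 = 1" if "add_dev g x > 0" for x
    using that by (simp add: add_moment_def flip: add_dev_square)
  obtain c X where c: "0 < c" "c \<le> 1" and X: "X > 0" and mgf:
    "\<And>x s. x \<ge> X \<Longrightarrow> add_dev g x > 0 \<Longrightarrow> 0 \<le> s \<Longrightarrow> s \<le> 1 \<Longrightarrow>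
      c * exp ((add_dev g x)\<^sup>2 * cumul (add_moment g x) s) \<le>
        (\<Sum>n\<in>posints_upto x. exp (s * (g n - add_mean g x))) / x \<and>
      (\<Sum>n\<in>posints_upto x. exp (s * (g n - add_mean g x))) / x \<le>
        exp ((add_dev g x)\<^sup>2 * cumul (add_moment g x) s)"
    using add_exp_moment[OF g gM] by blast
  \<comment> \<open>The logarithm of the total loss: \<open>8 * exp 1\<close> from the window
    comparison and \<open>1 / c\<close> from the lower Euler product bound.\<close>
  define C where "C = ln (8 * exp 1 / c)"
  have "1 \<le> 8 * exp 1 / c"
    using c exp_1_ge_2 by (simp add: field_simps)
  then have C: "C \<ge> 0" "exp C = 8 * exp 1 / c" using c by (auto simp: C_def)
  \<comment> \<open>Chosen so that \<open>H B ^ N = 1 / B\<close>, halfway between the error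
    \<open>1 / B\<^sup>2\<close> in the cumulants and no decay at all.\<close>
  define H where "H B = B powr (- (1 / real N))" for B :: real
  have N2: "N \<ge> 2" by (simp add: N_def)
  have H_lim: "(H \<longlongrightarrow> 0) at_top"
    unfolding H_def using N2 by (intro tendsto_neg_powr filterlim_ident) auto

  have cumul_close: "\<bar>cumul (add_moment g x) s - cumul m' s\<bar> \<le> C / (add_dev g x)\<^sup>2"
    if x: "x \<ge> X" and B: "add_dev g x \<ge> 16" "4 / c \<le> exp (add_dev g x / 4)"
      and s: "s = real j * H (add_dev g x)" "1 \<le> j" "j \<le> N" "s \<le> 1 / 2" "A * (2 * s) \<le> 1 / 4"
      and fr: "\<And>\<Delta>. 1 \<le> \<Delta> \<Longrightarrow> \<Delta> \<le> 4 * real N * add_dev g x powr (1 - 1 / real N) \<Longrightarrow>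
        \<bar>upper_freq g x \<Delta> /
          measure P {w \<in> space P. Z ((add_dev g x)\<^sup>2) w \<ge> \<Delta> * add_dev g x} - 1\<bar> < 1 / 2"
    for x s j
  proof -
    define B where "B = add_dev g x"
    have B16: "B \<ge> 16" and Bc: "4 / c \<le> exp (B / 4)" using B by (simp_all add: B_def)
    have x0: "x > 0" using x X by simp
    have h0: "H B > 0" using B16 by (simp add: H_def)
    have hs: "H B \<le> s" "s \<le> real N * H B"
      using s(1,2,3) h0 by (auto simp: B_def[symmetric])
    have HB: "H B * B = B powr (1 - 1 / real N)"
      using B16 by (simp add: H_def powr_diff powr_minus field_simps)
    \<comment> \<open>Here \<open>N \<ge> 2\<close> enters: \<open>s * B\<close> is at least
      \<open>B powr (1 - 1 / N)\<close>, hence at least the square root of \<open>B\<close>. With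
      \<open>B \<ge> 16\<close> this gives \<open>4 \<le> s * B\<close>.\<close>
    have "B = B powr 1" using B16 by simp
    also have "\<dots> \<le> B powr (2 * (1 - 1 / real N))"
      using B16 N2 by (intro powr_mono) (auto simp: field_simps)
    also have "\<dots> = (H B * B)\<^sup>2"
      using B16 unfolding HB by (simp add: power2_eq_square flip: powr_add)
    also have "\<dots> \<le> (s * B)\<^sup>2" using hs h0 B16 by (intro power_mono mult_right_mono) auto
    finally have sB2: "B \<le> (s * B)\<^sup>2" .
    have s0: "s > 0" using hs h0 by linarith
    have sB: "4 \<le> s * B"
    proof (rule power2_le_imp_le)
      show "4\<^sup>2 \<le> (s * B)\<^sup>2" using sB2 B16 by simp
    qed (use s0 B16 in auto)
    have "B / 4 \<le> B\<^sup>2 * s\<^sup>2 / 4" using sB2 by (simp add: power_mult_distrib mult.commute)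
    then have expc: "4 / c \<le> exp (B\<^sup>2 * s\<^sup>2 / 4)" using Bc by (meson exp_le_cancel_iff order_trans)
    have expc1: "4 / 1 \<le> exp (B\<^sup>2 * s\<^sup>2 / 4)"
    proof -
      have "4 / 1 \<le> 4 / c" using c by (intro divide_left_mono) auto
      then show ?thesis using expc by linarith
    qed
    \<comment> \<open>Weight \<open>1 / x\<close> on each positive integer up to \<open>x\<close>,
      to match \<open>upper_freq\<close>. The total mass may fall short of 1 when \<open>x\<close>
      is not an integer, so this is a finite measure of mass at most 1.\<close>
    define N1 where "N1 = point_measure (posints_upto x) (\<lambda>_. ennreal (1 / x))"
    define Y where "Y n = g n - add_mean g x" for n
    have N1_int: "(\<integral>n. f n \<partial>N1) = (\<Sum>n\<in>posints_upto x. f n) / x" for f :: "nat \<Rightarrow> real"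
      unfolding N1_def using x0 by (subst lebesgue_integral_point_measure_finite) (auto simp: sum_divide_distrib)
    have N1_integrable: "integrable N1 f" for f :: "nat \<Rightarrow> real"
      unfolding N1_def by (rule integrable_point_measure_finite) simp
    have N1_space: "space N1 = posints_upto x" by (simp add: N1_def space_point_measure)
    have N1_meas: "measure N1 S = real (card S) / x" if "S \<subseteq> posints_upto x" for S
      unfolding N1_def using that x0
      by (subst measure_point_measure_finite_if) (auto simp: field_simps)
    have N1_fin: "finite_measure N1"
      by (rule finite_measureI)
        (simp add: N1_def space_point_measure emeasure_point_measure_finite ennreal_mult_eq_top_iff)
    have mass: "measure N1 (space N1) \<le> 1"
      using card_multiples_le[of 1 x] x0 by (simp add: N1_space N1_meas field_simps)
    have Ymeas: "Y \<in> borel_measurable N1" by (simp add: N1_def)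
    have tail: "measure N1 {n \<in> space N1. v \<le> Y n} = upper_freq g x (v / B)" for v
    proof -
      have "{n \<in> space N1. v \<le> Y n} =
          {n. 1 \<le> n \<and> real n \<le> x \<and> v / B \<le> (g n - add_mean g x) / add_dev g x}"
        using B16 by (auto simp: N1_space posints_upto_def Y_def B_def[symmetric] divide_le_cancel)
      then show ?thesis
        by (subst N1_meas) (auto simp: N1_space upper_freq_def)
    qed
    have tails: "measure N1 {n \<in> space N1. v \<le> Y n} \<le> 2 * measure P {w \<in> space P. v \<le> Z (B\<^sup>2) w} \<and>
        measure P {w \<in> space P. v \<le> Z (B\<^sup>2) w} \<le> 2 * measure N1 {n \<in> space N1. v \<le> Y n}"
      if v: "B \<le> v" "v \<le> 4 * s * B\<^sup>2" for v
    proof -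
      define p where "p = measure P {w \<in> space P. v \<le> Z (B\<^sup>2) w}"
      have "1 \<le> v / B" using v B16 by simp
      moreover have "v / B \<le> 4 * real N * add_dev g x powr (1 - 1 / real N)"
      proof -
        have "v / B \<le> 4 * s * B" using v B16 by (simp add: field_simps power2_eq_square)
        also have "\<dots> \<le> 4 * (real N * H B) * B"
          using hs B16 by (intro mult_right_mono mult_left_mono) auto
        also have "\<dots> = 4 * real N * add_dev g x powr (1 - 1 / real N)"
          using HB by (simp add: B_def)
        finally show ?thesis .
      qed
      ultimately have "\<bar>upper_freq g x (v / B) /
          measure P {w \<in> space P. Z ((add_dev g x)\<^sup>2) w \<ge> v / B * add_dev g x} - 1\<bar> < 1 / 2"
        by (rule fr)
      also have "v / B * add_dev g x = v" using B16 by (simp add: B_def)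
      finally have *: "\<bar>upper_freq g x (v / B) / p - 1\<bar> < 1 / 2"
        by (simp add: p_def B_def)
      \<comment> \<open>Division by zero yields 0, and \<open>\<bar>0 - 1\<bar> < 1 / 2\<close>
        fails; the ratio condition itself thus excludes a vanishing tail.\<close>
      have "p \<noteq> 0" using * by auto
      then have "p > 0" by (simp add: p_def zero_less_measure_iff)
      moreover have "1 / 2 < upper_freq g x (v / B) / p" "upper_freq g x (v / B) / p < 3 / 2"
        using * unfolding abs_less_iff by linarith+
      ultimately have "p < 2 * upper_freq g x (v / B)" "2 * upper_freq g x (v / B) < 3 * p"
        by (auto simp: field_simps)
      then show ?thesis using \<open>p > 0\<close> unfolding tail p_def by linarith
    qed
    have B0: "add_dev g x > 0" using B16 by (simp add: B_def)
    have mgf1: "c * exp (B\<^sup>2 * cumul (add_moment g x) s) \<le> (\<integral>n. exp (s * Y n) \<partial>N1)"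
      "(\<integral>n. exp (s * Y n) \<partial>N1) \<le> exp (B\<^sup>2 * cumul (add_moment g x) s)"
      unfolding N1_int Y_def B_def using mgf[OF x B0, of s] s0 s(4) by auto
    have mgf2: "(\<integral>n. exp (2 * s * Y n) \<partial>N1) \<le> exp (B\<^sup>2 * cumul (add_moment g x) (2 * s))"
      unfolding N1_int Y_def B_def using mgf[OF x B0, of "2 * s"] s0 s(4) by auto
    have Zint: "integrable P (\<lambda>w. exp (r * Z (B\<^sup>2) w))" for r
      by (rule Z_exp_moment(1)[OF \<Psi> P Z]) simp
    have Zmgf: "(\<integral>w. exp (r * Z (B\<^sup>2) w) \<partial>P) = exp (B\<^sup>2 * cumul m' r)" for r
      unfolding m'_def by (rule Z_exp_moment(2)[OF \<Psi> P Z]) simp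
    have Zmeas: "Z (B\<^sup>2) \<in> borel_measurable P"
      using Z by (simp add: Z_family_def)
    have "(\<integral>n. exp (s * Y n) \<partial>N1) \<le> 8 * exp 1 * (\<integral>w. exp (s * Z (B\<^sup>2) w) \<partial>P)"
      by (rule exp_moment_window[where m = "add_moment g x" and A = A and c = c and B = B])
        (use N1_fin P.finite_measure_axioms mass Ymeas Zmeas N1_integrable Zint m[OF B0] m0[OF B0] A
          mgf1 mgf2 tails s0 s(5) B16 sB c expc in auto)
    then have 1: "c * exp (B\<^sup>2 * cumul (add_moment g x) s) \<le> 8 * exp 1 * exp (B\<^sup>2 * cumul m' s)"
      using mgf1 unfolding Zmgf by linarith
    \<comment> \<open>The same comparison with the roles exchanged; the exponential moment of
      \<open>Z\<close> is known exactly, so \<open>c = 1\<close> is admissible.\<close>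
    have "(\<integral>w. exp (s * Z (B\<^sup>2) w) \<partial>P) \<le> 8 * exp 1 * (\<integral>n. exp (s * Y n) \<partial>N1)"
      by (rule exp_moment_window[where m = m' and A = A and c = 1 and B = B])
        (use N1_fin P.finite_measure_axioms P.prob_space Ymeas Zmeas N1_integrable Zint m' m'0 A
          Zmgf tails s0 s(5) B16 sB expc1 in auto)
    then have "exp (B\<^sup>2 * cumul m' s) \<le> 8 * exp 1 * exp (B\<^sup>2 * cumul (add_moment g x) s)"
      unfolding Zmgf using mgf1(2) by (meson exp_ge_zero mult_left_mono order_trans zero_le_mult_iff zero_le_numeral)
    moreover have "c * exp (B\<^sup>2 * cumul m' s) \<le> 1 * exp (B\<^sup>2 * cumul m' s)"
      using c by (intro mult_right_mono) auto
    ultimately have 2: "c * exp (B\<^sup>2 * cumul m' s) \<le> 8 * exp 1 * exp (B\<^sup>2 * cumul (add_moment g x) s)"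
      by linarith
    have "exp (B\<^sup>2 * cumul (add_moment g x) s) \<le> exp (C + B\<^sup>2 * cumul m' s)"
      using 1 c unfolding exp_add C by (simp add: field_simps)
    moreover have "exp (B\<^sup>2 * cumul m' s) \<le> exp (C + B\<^sup>2 * cumul (add_moment g x) s)"
      using 2 c unfolding exp_add C by (simp add: field_simps)
    ultimately have "\<bar>B\<^sup>2 * (cumul (add_moment g x) s - cumul m' s)\<bar> \<le> C"
      by (simp add: right_diff_distrib abs_le_iff)
    then have "B\<^sup>2 * \<bar>cumul (add_moment g x) s - cumul m' s\<bar> \<le> C"
      by (simp only: abs_mult abs_power2)
    then show ?thesis
      using B16 by (simp add: B_def[symmetric] pos_le_divide_eq mult.commute)
  qed

  \<comment> \<open>The bound of \<open>moment_diff_le\<close> multiplied by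
    \<open>B = 1 / H B ^ N\<close>: the cumulant error becomes \<open>C / B\<close> and the Taylor
    remainder keeps one factor \<open>H B\<close>.\<close>
  define R where "R B = 2 ^ N * (C / B + exp A * real N ^ Suc N * H B)" for B
  have "\<forall>\<^sub>F x in at_top. norm (add_moment g x k - m' k) \<le> R (add_dev g x)"
  proof -
    \<comment> \<open>The threshold gives \<open>8 * (A + 1) * s \<le> 1\<close> at all nodes, hence
      both \<open>A * (2 * s) \<le> 1 / 4\<close> and \<open>s \<le> 1 / 2\<close>; the latter keeps
      \<open>2 * s\<close> in the range of \<open>add_exp_moment\<close>.\<close>
    have "\<forall>\<^sub>F B in at_top. H B < 1 / (8 * (A + 1) * real N)"
      using A N2 by (intro order_tendstoD[OF H_lim]) auto
    then have e1: "\<forall>\<^sub>F x in at_top. H (add_dev g x) < 1 / (8 * (A + 1) * real N)"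
      by (rule eventually_compose_filterlim[OF _ lim])
    have e2: "\<forall>\<^sub>F x in at_top. add_dev g x \<ge> 16"
      by (rule eventually_compose_filterlim[OF eventually_ge_at_top lim])
    have e3: "\<forall>\<^sub>F x in at_top. 4 / c \<le> exp (add_dev g x / 4)"
    proof (rule eventually_compose_filterlim[OF _ lim])
      have "filterlim (\<lambda>B::real. exp (B / 4)) at_top at_top" by real_asymp
      then show "\<forall>\<^sub>F B::real in at_top. 4 / c \<le> exp (B / 4)"
        by (simp add: filterlim_at_top)
    qed
    \<comment> \<open>The cut-off \<open>v \<le> 4 * s * B\<^sup>2\<close> with
      \<open>s \<le> N * H B\<close> means \<open>v / B \<le> 4 * N * B powr (1 - 1 / N)\<close>.
      This fixes both parameters of the range; the tolerance \<open>1 / 2\<close> yields the factor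
      2 between the tails.\<close>
    have e4: "\<forall>\<^sub>F x in at_top. \<forall>\<Delta>. 1 \<le> \<Delta> \<and> \<Delta> \<le> 4 * real N * add_dev g x powr (1 - 1 / real N) \<longrightarrow>
        \<bar>upper_freq g x \<Delta> /
          measure P {w \<in> space P. Z ((add_dev g x)\<^sup>2) w \<ge> \<Delta> * add_dev g x} - 1\<bar> < 1 / 2"
      using N2 by (intro freq) auto
    show ?thesis
      using e1 e2 e3 e4 eventually_ge_at_top[of X]
    proof eventually_elim
      case (elim x)
      define B where "B = add_dev g x"
      have B: "B \<ge> 16" using elim by (simp add: B_def)
      have h0: "H B > 0" using B by (simp add: H_def)
      have Nh: "real N * H B * (8 * (A + 1)) \<le> 1"
      proof -
        have "H B * (8 * (A + 1) * real N) < 1"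
          using elim(1) A N2 unfolding B_def by (subst (asm) pos_less_divide_eq) auto
        moreover have "real N * H B * (8 * (A + 1)) = H B * (8 * (A + 1) * real N)" by simp
        ultimately show ?thesis by linarith
      qed
      have bnd: "s \<le> 1 / 2" "A * (2 * s) \<le> 1 / 4" if "0 \<le> s" "s \<le> real N * H B" for s
      proof -
        have "s * (8 * (A + 1)) \<le> real N * H B * (8 * (A + 1))"
          using that A by (intro mult_right_mono) auto
        then have *: "8 * (A * s) + 8 * s \<le> 1" using Nh by (simp add: algebra_simps)
        have "0 \<le> A * s" using that A by simp
        with * that show "s \<le> 1 / 2" "A * (2 * s) \<le> 1 / 4" by linarith+
      qed
      have "\<bar>add_moment g x k - m' k\<bar> * H B ^ (k + 2) \<le>
          2 ^ (k + 2) * (C / B\<^sup>2 + exp A * (real (k + 2) * H B) ^ (k + 3))"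
      proof (rule moment_diff_le)
        show "real (k + 2) * H B \<le> 1"
          using bnd(1)[of "real N * H B"] h0 by (simp add: N_def)
        fix j assume j: "1 \<le> j" "j \<le> k + 2"
        have "real j * H B \<le> real N * H B" using j h0 by (intro mult_right_mono) (auto simp: N_def)
        then show "\<bar>cumul (add_moment g x) (real j * H B) - cumul m' (real j * H B)\<bar> \<le> C / B\<^sup>2"
          unfolding B_def using elim(4) j bnd[of "real j * H B"] h0
          by (intro cumul_close[OF elim(5,2,3) refl]) (auto simp: B_def N_def)
      qed (use m[of x] m' A h0 B C in \<open>auto simp: B_def\<close>)
      also have "H B ^ (k + 2) = 1 / B"
      proof -
        have "H B ^ (k + 2) = B powr (- (1 / real N) * real (k + 2))"
          using B by (simp add: H_def powr_power del: power_Suc)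
        also have "\<dots> = 1 / B" using B by (simp add: N_def powr_minus_divide del: of_nat_add)
        finally show ?thesis .
      qed
      also have "(real (k + 2) * H B) ^ (k + 3) = real N ^ Suc N * (H B / B)"
      proof -
        have "(real (k + 2) * H B) ^ (k + 3) = real N ^ Suc N * (H B ^ (k + 2) * H B)"
          by (simp add: N_def power_mult_distrib eval_nat_numeral mult_ac)
        also have "H B ^ (k + 2) * H B = H B / B"
          unfolding \<open>H B ^ (k + 2) = 1 / B\<close> by simp
        finally show ?thesis .
      qed
      finally have "\<bar>add_moment g x k - m' k\<bar> * (1 / B) * B \<le>
          2 ^ N * (C / B\<^sup>2 + exp A * (real N ^ Suc N * (H B / B))) * B"
        using B unfolding N_def by (intro mult_right_mono) auto
      also have "\<dots> = R B"
        using B by (simp add: R_def field_simps power2_eq_square del: power_Suc)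
      finally show ?case using B by (simp add: B_def)
    qed
  qed
  moreover have "((\<lambda>x. R (add_dev g x)) \<longlongrightarrow> 0) at_top"
  proof -
    have "((\<lambda>B. C / B) \<longlongrightarrow> 0) at_top" by real_asymp
    then have "(R \<longlongrightarrow> 2 ^ N * (0 + exp A * real N ^ Suc N * 0)) at_top"
      unfolding R_def by (intro tendsto_intros H_lim)
    then show ?thesis using filterlim_compose[OF _ lim] by simp
  qed
  ultimately have "((\<lambda>x. add_moment g x k - m' k) \<longlongrightarrow> 0) at_top"
    by (rule Lim_null_comparison)
  then show ?thesis by (simp add: m'_def LIM_zero_iff)
qed

text \<open>This turns the weighted sums over primes into a probability law on the line, so that the
  method of moments applies. The mass is 1 because \<open>add_dev\<close> squared is the sum of the
  weights.\<close>

lemma weighted_prime_law: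
  assumes B: "add_dev g x > 0" and gM: "\<And>p. prime p \<Longrightarrow> 0 \<le> g p \<and> g p \<le> M"
  defines "F \<equiv> distr (point_measure (primes_upto x)
      (\<lambda>p. ennreal ((g p)\<^sup>2 / real p / (add_dev g x)\<^sup>2))) borel g"
  shows "real_distribution F" "AE y in F. \<bar>y\<bar> \<le> M" "(\<integral>y. y ^ k \<partial>F) = add_moment g x k"
    "cdf F t = (\<Sum>p\<in>{p \<in> primes_upto x. g p \<le> t}. (g p)\<^sup>2 / real p) / (add_dev g x)\<^sup>2"
proof -
  define Q where "Q = point_measure (primes_upto x) (\<lambda>p. ennreal ((g p)\<^sup>2 / real p / (add_dev g x)\<^sup>2))"
  have Q: "space Q = primes_upto x" "g \<in> borel_measurable Q"
    by (auto simp: Q_def space_point_measure)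
  have "emeasure Q (space Q) = ennreal (\<Sum>p\<in>primes_upto x. (g p)\<^sup>2 / real p / (add_dev g x)\<^sup>2)"
    unfolding Q_def by (simp add: space_point_measure emeasure_point_measure_finite)
  also have "(\<Sum>p\<in>primes_upto x. (g p)\<^sup>2 / real p / (add_dev g x)\<^sup>2) = 1"
    using B by (subst sum_divide_distrib[symmetric]) (simp flip: add_dev_square)
  finally have "prob_space Q" by (intro prob_spaceI) simp
  then interpret Q: prob_space Q .
  have F: "F = distr Q borel g" by (simp add: F_def Q_def)
  show "real_distribution F" unfolding F by (rule Q.real_distribution_distr) (rule Q)
  have "AE p in Q. \<bar>g p\<bar> \<le> M"
    using gM unfolding Q_def by (auto simp: AE_point_measure primes_upto_def)
  then show "AE y in F. \<bar>y\<bar> \<le> M" unfolding F using Q by (subst AE_distr_iff) auto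
  show "(\<integral>y. y ^ k \<partial>F) = add_moment g x k"
    unfolding F using Q
    by (subst integral_distr)
      (auto simp: Q_def lebesgue_integral_point_measure_finite add_moment_def sum_divide_distrib)
  have "cdf F t = measure Q {p \<in> primes_upto x. g p \<le> t}"
    unfolding F cdf_def using Q
    by (subst measure_distr) (auto intro!: arg_cong[where f = "measure Q"])
  also have "\<dots> = (\<Sum>p\<in>{p \<in> primes_upto x. g p \<le> t}. (g p)\<^sup>2 / real p / (add_dev g x)\<^sup>2)"
    unfolding Q_def by (subst measure_point_measure_finite_if) auto
  finally show "cdf F t = (\<Sum>p\<in>{p \<in> primes_upto x. g p \<le> t}. (g p)\<^sup>2 / real p) / (add_dev g x)\<^sup>2"
    by (simp add: sum_divide_distrib)
qed

theorem theorem2: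
  fixes g :: "nat \<Rightarrow> real" and M :: real and \<Psi> :: "real \<Rightarrow> real" and \<alpha> :: real
    and P :: "'w measure" and Z :: "real \<Rightarrow> 'w \<Rightarrow> real"
  assumes "strongly_additive g"
    and "\<And>p. prime p \<Longrightarrow> 0 \<le> g p \<and> g p \<le> M"
    and "filterlim (add_dev g) at_top at_top"
    and "distribution_function \<Psi>" and "\<Psi> \<noteq> delta0"
    and "\<alpha> > 0" and "\<Psi> \<alpha> - \<Psi> 0 = 1"
    and "prob_space P" and "Z_family P \<Psi> Z"
    and "\<And>\<epsilon> c \<eta> :: real. \<epsilon> > 0 \<Longrightarrow> c > 0 \<Longrightarrow> \<eta> > 0 \<Longrightarrow>
      \<forall>\<^sub>F x in at_top. \<forall>\<Delta>. 1 \<le> \<Delta> \<and> \<Delta> \<le> c * add_dev g x powr (1 - \<epsilon>) \<longrightarrow>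
        \<bar>upper_freq g x \<Delta> /
          measure P {w \<in> space P. Z ((add_dev g x)\<^sup>2) w \<ge> \<Delta> * add_dev g x} - 1\<bar> < \<eta>"
  shows "\<forall>t. isCont \<Psi> t \<longrightarrow>
    ((\<lambda>x. (\<Sum>p\<in>{p \<in> primes_upto x. g p \<le> t}. (g p)\<^sup>2 / real p) / (add_dev g x)\<^sup>2)
       \<longlongrightarrow> \<Psi> t) at_top"
proof (intro allI impI)
  fix t assume t: "isCont \<Psi> t"
  note \<nu> = distribution_function_measure[OF assms(4)]
  define F where "F x = distr (point_measure (primes_upto x)
      (\<lambda>p. ennreal ((g p)\<^sup>2 / real p / (add_dev g x)\<^sup>2))) borel g" for x
  have law: "real_distribution (F x)" "AE y in F x. \<bar>y\<bar> \<le> M" "(\<integral>y. y ^ k \<partial>F x) = add_moment g x k"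
      "cdf (F x) t = (\<Sum>p\<in>{p \<in> primes_upto x. g p \<le> t}. (g p)\<^sup>2 / real p) / (add_dev g x)\<^sup>2"
    if "add_dev g x > 0" for x k t
    unfolding F_def by (rule weighted_prime_law[where M = M]; use that assms(2) in blast)+
  show "((\<lambda>x. (\<Sum>p\<in>{p \<in> primes_upto x. g p \<le> t}. (g p)\<^sup>2 / real p) / (add_dev g x)\<^sup>2)
       \<longlongrightarrow> \<Psi> t) at_top"
  proof (rule tendsto_at_topI_sequentially)
    \<comment> \<open>Weak convergence is formulated for sequences of measures, so the limit over
      real \<open>x\<close> is tested along arbitrary sequences tending to infinity.\<close>
    fix X :: "nat \<Rightarrow> real" assume X: "filterlim X at_top sequentially"
    have "\<forall>\<^sub>F n in sequentially. add_dev g (X n) > 0"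
      by (rule eventually_compose_filterlim[OF eventually_gt_at_top filterlim_compose[OF assms(3) X]])
    then obtain n0 where "\<And>n. n \<ge> n0 \<Longrightarrow> add_dev g (X n) > 0"
      by (auto simp: eventually_sequentially)
    \<comment> \<open>Shifting the index makes every measure of the sequence a probability law, as
      \<open>weak_conv_m_of_moments\<close> demands; the shift is undone at the end.\<close>
    then have n0: "add_dev g (X (n + n0)) > 0" for n by simp
    have X': "filterlim (\<lambda>n. X (n + n0)) at_top sequentially"
      using X filterlim_add_const_nat_at_top by (rule filterlim_compose)
    have "weak_conv_m (\<lambda>n. F (X (n + n0))) (interval_measure \<Psi>)"
    proof (rule weak_conv_m_of_moments[where A = "max M \<alpha>"])
      show "AE y in F (X (n + n0)). \<bar>y\<bar> \<le> max M \<alpha>" for n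
        using law(2)[OF n0[of n]] by eventually_elim auto
      show "AE y in interval_measure \<Psi>. \<bar>y\<bar> \<le> max M \<alpha>"
        using distribution_function_support[OF assms(4,6,7)] by eventually_elim auto
      fix k
      have "((\<lambda>x. add_moment g x k) \<longlongrightarrow> (\<integral>y. y ^ k \<partial>interval_measure \<Psi>)) at_top"
        by (rule add_moment_tendsto[OF assms(1-4) assms(6-10)])
      from filterlim_compose[OF this X']
      show "(\<lambda>n. \<integral>y. y ^ k \<partial>F (X (n + n0))) \<longlonglongrightarrow> (\<integral>y. y ^ k \<partial>interval_measure \<Psi>)"
        by (simp add: law(3)[OF n0])
    qed (use law(1)[OF n0] \<nu> in auto)
    then have "(\<lambda>n. cdf (F (X (n + n0))) t) \<longlonglongrightarrow> \<Psi> t"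
      using t unfolding weak_conv_m_def weak_conv_def \<nu>(2) by blast
    then have "(\<lambda>n. (\<Sum>p\<in>{p \<in> primes_upto (X (n + n0)). g p \<le> t}. (g p)\<^sup>2 / real p) /
        (add_dev g (X (n + n0)))\<^sup>2) \<longlonglongrightarrow> \<Psi> t"
      by (simp add: law(4)[OF n0])
    then show "(\<lambda>n. (\<Sum>p\<in>{p \<in> primes_upto (X n). g p \<le> t}. (g p)\<^sup>2 / real p) / (add_dev g (X n))\<^sup>2)
        \<longlonglongrightarrow> \<Psi> t"
      by (rule LIMSEQ_offset)
  qed
qed

end
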